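(* Let $\mathbf X=(X_t)_{t\in I}$ be an OPM process with orthogonal polynomial martingales $\{p_n(x;t)\}_{n\ge0}$, whose one-dimensional laws $\mu(\cdot,t)$ and transition laws $\eta(\cdot,t;y,s)$ satisfy: for all $s<t$ and $y\in\operatorname{supp}\mu(\cdot,s)$, $\eta(\cdot,t;y,s)\ll\mu(\cdot,t)$ with Radon–Nikodym derivative square integrable with respect to $\mu(\cdot,t)$. Let the polynomials satisfy the three-term recurrence $$xp_n(x;t)=\alpha_{n+1}(t)p_{n+1}(x;t)+\beta_n(t)p_n(x;t)+\gamma_{n-1}(t)p_{n-1}(x;t),\quad p_{-1}=0,\ p_0=1.$$ Then $\mathbf X$ is a harness if and only if $$\beta_n(t)=\beta_0(t)+b_n\alpha_1(t)+\hat b_n\gamma_0(t),\quad \alpha_n(t)=a_n\alpha_1(t)+\hat a_n\gamma_0(t),\quad \gamma_n(t)=c_n\alpha_1(t)+\hat c_n\gamma_0(t)$$ for all $n$ and $t\in I$, where $\{a_n,\hat a_n,b_n,\hat b_n,c_n,\hat c_n\}_{n\ge0}$ are real number sequences with $b_0=\hat b_0=\hat a_0=a_0=\hat a_1=c_0=0$, $a_1=\hat c_0=1$, and $\alpha_n(t)\gamma_{n-1}(t)>0$ for all $t\in I$, $n\ge1$.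
   Context: $I$ is a segment of the real line; $\mathbf X$ is a real Markov process with all moments finite, infinite support of every $X_t$, and each one-dimensional law determined by its moments; $\mathcal F_{\le s}=\sigma(X_v:v\in I,v\le s)$, $\mathcal F_{s,u}=\sigma(X_v:v\in I,v\notin(s,u))$. $\mu(\cdot,t)$ is the law of $X_t$, $\eta(\cdot,t;y,s)=P(X_t\in\cdot\mid X_s=y)$. $\mathbf X$ is an OPM process if it is an MPR process (for every $n$ and $s\le t$, $E(X_t^n\mid\mathcal F_{\le s})$ is a polynomial of degree at most $n$ in $X_s$, with the non-degeneracy and continuity conditions of the MPR class) and there exist polynomials $p_n(x;t)$ of degree $n$ in $x$, $p_0=1$, with $E p_n(X_t;t)p_m(X_t;t)=\hat p_n(t)\delta_{n,m}$ and $E(p_n(X_t;t)\mid\mathcal F_{\le s})=p_n(X_s;s)$ a.s. for $s\le t$. $\mathbf X$ is a harness if for all $s<t<u$ in $I$, $E(X_t\mid\mathcal F_{s,u})$ is a.s. a polynomial of degree (at most) $1$ in $X_s$ and $X_u$ (with coefficients depending on $s,t,u$). *)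

theory Defs
  imports "HOL-Probability.Probability" "HOL-Computational_Algebra.Polynomial"
begin

definition gen_sigma :: "'a measure \<Rightarrow> (real \<Rightarrow> 'a \<Rightarrow> real) \<Rightarrow> real set \<Rightarrow> 'a measure" where
  "gen_sigma M X S = sigma (space M) {X v -` B \<inter> space M | v B. v \<in> S \<and> B \<in> sets borel}"

definition past_sigma :: "'a measure \<Rightarrow> (real \<Rightarrow> 'a \<Rightarrow> real) \<Rightarrow> real set \<Rightarrow> real \<Rightarrow> 'a measure" where
  "past_sigma M X I s = gen_sigma M X {v \<in> I. v \<le> s}"

definition outer_sigma :: "'a measure \<Rightarrow> (real \<Rightarrow> 'a \<Rightarrow> real) \<Rightarrow> real set \<Rightarrow> real \<Rightarrow> real \<Rightarrow> 'a measure" where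
  "outer_sigma M X I s u = gen_sigma M X {v \<in> I. v \<notin> {s<..<u}}"

definition law :: "'a measure \<Rightarrow> (real \<Rightarrow> 'a \<Rightarrow> real) \<Rightarrow> real \<Rightarrow> real measure" where
  "law M X t = distr M borel (X t)"

definition measure_support :: "real measure \<Rightarrow> real set" where
  "measure_support \<mu> = {x. \<forall>e>0. emeasure \<mu> (ball x e) > 0}"

definition markov_process :: "'a measure \<Rightarrow> (real \<Rightarrow> 'a \<Rightarrow> real) \<Rightarrow> real set \<Rightarrow> bool" where
  "markov_process M X I \<longleftrightarrow>
     prob_space M \<and>
     (\<forall>t\<in>I. X t \<in> borel_measurable M) \<and>
     (\<forall>s\<in>I. \<forall>t\<in>I. s \<le> t \<longrightarrow> (\<forall>B\<in>sets borel.
        AE \<omega> in M. real_cond_exp M (past_sigma M X I s) (\<lambda>\<omega>. indicator B (X t \<omega>)) \<omega>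
                  = real_cond_exp M (gen_sigma M X {s}) (\<lambda>\<omega>. indicator B (X t \<omega>)) \<omega>))"

definition standing_process :: "'a measure \<Rightarrow> (real \<Rightarrow> 'a \<Rightarrow> real) \<Rightarrow> real set \<Rightarrow> bool" where
  "standing_process M X I \<longleftrightarrow>
     markov_process M X I \<and>
     (\<forall>t\<in>I. \<forall>n::nat. integrable M (\<lambda>\<omega>. X t \<omega> ^ n)) \<and>
     (\<forall>t\<in>I. infinite (measure_support (law M X t))) \<and>
     (\<forall>t\<in>I. \<forall>\<nu>::real measure. prob_space \<nu> \<and> sets \<nu> = sets borel \<and>
        (\<forall>n::nat. integrable \<nu> (\<lambda>x. x ^ n) \<and> (\<integral>x. x ^ n \<partial>\<nu>) = (\<integral>\<omega>. X t \<omega> ^ n \<partial>M))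
        \<longrightarrow> \<nu> = law M X t)"

definition MPR :: "'a measure \<Rightarrow> (real \<Rightarrow> 'a \<Rightarrow> real) \<Rightarrow> real set \<Rightarrow> bool" where
  "MPR M X I \<longleftrightarrow>
     standing_process M X I \<and>
     (\<exists>c :: nat \<Rightarrow> nat \<Rightarrow> real \<Rightarrow> real \<Rightarrow> real. \<forall>n::nat.
        (\<forall>s\<in>I. \<forall>t\<in>I. s \<le> t \<longrightarrow>
           c n n s t \<noteq> 0 \<and>
           (AE \<omega> in M. real_cond_exp M (past_sigma M X I s) (\<lambda>\<omega>. X t \<omega> ^ n) \<omega>
                        = (\<Sum>j\<le>n. c n j s t * X s \<omega> ^ j))) \<and>
        (\<forall>j\<le>n. continuous_on {(s, t). s \<in> I \<and> t \<in> I \<and> s \<le> t} (\<lambda>(s, t). c n j s t)))"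

definition OPM :: "'a measure \<Rightarrow> (real \<Rightarrow> 'a \<Rightarrow> real) \<Rightarrow> real set \<Rightarrow> (nat \<Rightarrow> real \<Rightarrow> real poly) \<Rightarrow> bool" where
  "OPM M X I p \<longleftrightarrow>
     MPR M X I \<and>
     (\<forall>t\<in>I. \<forall>n. degree (p n t) = n) \<and>
     (\<forall>t\<in>I. p 0 t = 1) \<and>
     (\<exists>phat :: nat \<Rightarrow> real \<Rightarrow> real. \<forall>t\<in>I. \<forall>n m.
        (\<integral>\<omega>. poly (p n t) (X t \<omega>) * poly (p m t) (X t \<omega>) \<partial>M) = (if n = m then phat n t else 0)) \<and>
     (\<forall>s\<in>I. \<forall>t\<in>I. s \<le> t \<longrightarrow> (\<forall>n.
        AE \<omega> in M. real_cond_exp M (past_sigma M X I s) (\<lambda>\<omega>. poly (p n t) (X t \<omega>)) \<omega>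
                     = poly (p n s) (X s \<omega>)))"

definition transition_kernel :: "'a measure \<Rightarrow> (real \<Rightarrow> 'a \<Rightarrow> real) \<Rightarrow> real set
    \<Rightarrow> (real \<Rightarrow> real \<Rightarrow> real \<Rightarrow> real measure) \<Rightarrow> bool" where
  "transition_kernel M X I \<eta> \<longleftrightarrow>
     (\<forall>s\<in>I. \<forall>t\<in>I. s < t \<longrightarrow>
        (\<forall>y. prob_space (\<eta> t y s) \<and> sets (\<eta> t y s) = sets borel) \<and>
        (\<forall>B\<in>sets borel. (\<lambda>y. measure (\<eta> t y s) B) \<in> borel_measurable borel \<and>
           (AE \<omega> in M. real_cond_exp M (gen_sigma M X {s}) (\<lambda>\<omega>. indicator B (X t \<omega>)) \<omega>
                        = measure (\<eta> t (X s \<omega>) s) B)))"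

definition harness :: "'a measure \<Rightarrow> (real \<Rightarrow> 'a \<Rightarrow> real) \<Rightarrow> real set \<Rightarrow> bool" where
  "harness M X I \<longleftrightarrow>
     (\<forall>s\<in>I. \<forall>t\<in>I. \<forall>u\<in>I. s < t \<and> t < u \<longrightarrow>
        (\<exists>a b c :: real. AE \<omega> in M.
           real_cond_exp M (outer_sigma M X I s u) (X t) \<omega> = a + b * X s \<omega> + c * X u \<omega>))"

end

theory Submission
  imports Defs
begin

text \<open>The recurrence coefficients form a Jacobi matrix, whose \<open>(m, n)\<close> entry at time \<open>t\<close> is a multiple of
  \<open>E (p\<^sub>m(X\<^sub>s; s) X\<^sub>t p\<^sub>n(X\<^sub>t; t))\<close>, for every \<open>s \<le> t\<close>. Testing \<open>E (X\<^sub>t | F\<^sub>s\<^sub>,\<^sub>u) = a + b X\<^sub>s + c X\<^sub>u\<close> against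
  \<open>p\<^sub>m(X\<^sub>s; s) p\<^sub>n(X\<^sub>u; u)\<close> shows that the matrix at \<open>t\<close> is \<open>a\<close> times the identity plus \<open>b\<close> and \<open>c\<close> times the
  matrices at \<open>s\<close> and \<open>u\<close>. Hence two times with independent values of \<open>(\<alpha>\<^sub>1, \<gamma>\<^sub>0)\<close> determine all coefficients.
  If there are no such times, then \<open>E (p\<^sub>1(X\<^sub>t; t)\<^sup>2) = \<gamma>\<^sub>0 / \<alpha>\<^sub>1\<close> is constant, so the martingale
  \<open>p\<^sub>1(X\<^sub>t; t)\<close> is constant and \<open>X\<^sub>t\<close> is an affine function of \<open>X\<^sub>s\<close>.

  Conversely, choose \<open>a, b, c\<close> so that this relation holds for the coefficients at \<open>s, t, u\<close>. Then
  \<open>W = X\<^sub>t - a - b X\<^sub>s - c X\<^sub>u\<close>, restricted to an event of the past of \<open>s\<close>, is orthogonal to all polynomials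
  in \<open>X\<^sub>u\<close>. By a theorem of M. Riesz, determinacy of the law of \<open>X\<^sub>u\<close> makes it orthogonal to all functions of
  \<open>X\<^sub>u\<close>, and by the Markov property to all events of the future of \<open>u\<close>.

  For Riesz's theorem, Gauss quadratures \<open>\<sigma>\<^sub>n\<close> of a determinate law \<open>\<mu>\<close> converge weakly to \<open>\<mu>\<close>. With
  \<open>Q(x) = |x - z|\<^sup>2\<close> and nodes at the zeros of a polynomial \<open>P\<^sub>n\<close> with \<open>P\<^sub>n(z) = i\<close>, the integrals of
  \<open>1 / Q\<close> against \<open>\<sigma>\<^sub>n\<close> and \<open>\<mu>\<close> differ by that of \<open>P\<^sub>n\<^sup>2 / Q\<close> against \<open>\<mu>\<close>. So the latter tends to zero, and
  \<open>1 / (x - z)\<close> is a limit of polynomials in \<open>L\<^sup>2(\<mu>)\<close>.\<close>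

section \<open>Gauss quadrature\<close>

lemma borel_measurable_poly [measurable]:
  fixes q :: "real poly"
  shows "poly q \<in> borel_measurable borel"
  by (intro borel_measurable_continuous_onI continuous_intros)

section \<open>Sign changes and linear factors of real polynomials\<close>

text \<open>Induction on the degree: a root has order at least two, so the square of its linear
  factor can be divided off without changing signs or parities. A polynomial without roots has
  constant sign by the intermediate value theorem.\<close>

lemma poly_constant_sign_if_even_order:
  fixes p :: "real poly"
  assumes "p \<noteq> 0" "\<And>x. even (order x p)"
  shows "(\<forall>x. 0 \<le> poly p x) \<or> (\<forall>x. poly p x \<le> 0)"
  using assms
proof (induction "degree p" arbitrary: p rule: less_induct)
  case less
  show ?case
  proof (cases "\<exists>y. poly p y = 0")
    case True
    then obtain y where y: "poly p y = 0" by blast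
    have "order y p \<noteq> 0" using y less.prems(1) order_root by blast
    with less.prems(2)[of y] have "2 \<le> order y p" by presburger
    then have "[:-y,1:]^2 dvd p" using order_divides[of y 2 p] by blast
    then obtain q where q: "p = [:-y,1:]^2 * q" by blast
    have q0: "q \<noteq> 0" using q less.prems(1) by auto
    have deg: "degree p = 2 + degree q"
      unfolding q by (subst degree_mult_eq) (use q0 in \<open>auto simp: degree_power_eq\<close>)
    have "even (order x q)" for x
    proof -
      have "order x p = order x [:-y,1:] + order x [:-y,1:] + order x q"
        using order_mult[of "[:-y,1:] * [:-y,1:]" q x] order_mult[of "[:-y,1:]" "[:-y,1:]" x] q0
        unfolding q power2_eq_square by (metis mult_eq_0_iff pCons_eq_0_iff one_neq_zero)
      then show ?thesis using less.prems(2)[of x] by presburger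
    qed
    then have "(\<forall>x. 0 \<le> poly q x) \<or> (\<forall>x. poly q x \<le> 0)"
      using less.hyps[of q] deg q0 by auto
    then show ?thesis unfolding q by (auto simp: mult_nonneg_nonpos)
  next
    case False
    show ?thesis
    proof (rule ccontr)
      assume "\<not> ?thesis"
      then obtain a b where ab: "poly p a < 0" "poly p b > 0" by (auto simp: not_le)
      then have "a \<noteq> b" by auto
      then consider "a < b" | "b < a" by linarith
      then show False
        using poly_IVT_pos[of a b p] poly_IVT_neg[of b a p] ab False by cases auto
    qed
  qed
qed

lemma linear_factors_nonzero: "finite Z \<Longrightarrow> (\<Prod>z\<in>Z. [:-z,1::real:]) \<noteq> 0"
  by (subst prod_zero_iff) auto

lemma order_linear_factors:
  "finite Z \<Longrightarrow> order x (\<Prod>z\<in>Z. [:-z,1::real:]) = (if x \<in> Z then 1 else 0)"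
proof (induction Z rule: finite_induct)
  case (insert z Z)
  have "order x (\<Prod>z\<in>insert z Z. [:-z,1:]) = order x [:-z,1:] + order x (\<Prod>z\<in>Z. [:-z,1:])"
    using insert.hyps linear_factors_nonzero[of "insert z Z"] by (simp add: order_mult del: mult_pCons_left)
  moreover have "order x [:-z,1:] = (if x = z then 1 else 0)"
    using order_power_n_n[of z 1] by (auto intro: order_0I)
  ultimately show ?case using insert by auto
qed auto

lemma linear_factors_dvd:
  fixes P :: "real poly"
  assumes "finite Z" "Z \<subseteq> {x. poly P x = 0}"
  shows "(\<Prod>z\<in>Z. [:-z,1:]) dvd P"
  using assms
proof (induction Z rule: finite_induct)
  case (insert z Z)
  then obtain T where T: "P = (\<Prod>z\<in>Z. [:-z,1:]) * T" by auto
  have "poly (\<Prod>z\<in>Z. [:-z,1:]) z \<noteq> 0" using insert.hyps by (auto simp: poly_prod)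
  then have "[:-z,1:] dvd T" using insert.prems T by (auto simp: poly_eq_0_iff_dvd)
  then show ?case using insert.hyps unfolding T by (simp add: mult_dvd_mono mult.commute del: mult_pCons_left mult_pCons_right)
qed auto

section \<open>Laws with all moments and infinite support, and their quadratures\<close>

locale moment_distribution = real_distribution \<mu> for \<mu> :: "real measure" +
  assumes moments: "\<And>n::nat. integrable \<mu> (\<lambda>x. x ^ n)"
    and infinite_support: "infinite (measure_support \<mu>)"
begin

lemma integrable_poly: "integrable \<mu> (poly q)"
proof -
  have "poly q = (\<lambda>x. \<Sum>i\<le>degree q. coeff q i * x ^ i)" by (simp add: poly_altdef fun_eq_iff)
  then show ?thesis using moments by simp
qed

lemma integrable_poly_mult: "integrable \<mu> (\<lambda>x. poly q x * poly r x)"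
proof -
  have "(\<lambda>x. poly q x * poly r x) = poly (q * r)" by (simp add: fun_eq_iff)
  then show ?thesis using integrable_poly[of "q * r"] by simp
qed

text \<open>The finitely many roots of a nonzero \<open>q\<close> cannot exhaust the infinite
  support, and around a support point that is not a root there is a ball of positive measure without
  roots. Hence the moments define a genuine inner product on polynomials.\<close>

lemma AE_poly_zeroD:
  assumes "AE x in \<mu>. poly q x = 0"
  shows "q = 0"
proof (rule ccontr)
  assume "q \<noteq> 0"
  then have "finite {x. poly q x = 0}" by (rule poly_roots_finite)
  then obtain x where x: "x \<in> measure_support \<mu>" "poly q x \<noteq> 0"
    using infinite_support by (metis (mono_tags, lifting) finite_subset mem_Collect_eq subsetI)
  have "open {y. poly q y \<noteq> 0}" by (intro open_Collect_neq continuous_intros)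
  then obtain e where e: "e > 0" "ball x e \<subseteq> {y. poly q y \<noteq> 0}"
    using x(2) open_contains_ball by blast
  have "emeasure \<mu> (ball x e) > 0" using x(1) e(1) by (simp add: measure_support_def)
  moreover have "AE y in \<mu>. y \<notin> ball x e" using assms e(2) by (auto elim!: eventually_mono)
  then have "emeasure \<mu> (ball x e) = 0" by (subst (asm) AE_iff_measurable[of "ball x e"]) auto
  ultimately show False by simp
qed

lemma integral_poly_nonneg_zeroD:
  assumes "\<And>x. 0 \<le> poly q x" "(\<integral>x. poly q x \<partial>\<mu>) = 0"
  shows "q = 0"
  using assms integrable_poly[of q] by (intro AE_poly_zeroD) (subst (asm) integral_nonneg_eq_0_iff_AE, auto)

text \<open>If \<open>P\<close> had fewer than \<open>n\<close> sign changes, then multiplying it by the product of the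
  corresponding linear factors would give a polynomial of constant sign with zero integral.\<close>

lemma quasi_orthogonal_roots:
  assumes P: "P \<noteq> 0" "degree P \<le> Suc n"
    and orth: "\<And>R. degree R < n \<Longrightarrow> (\<integral>x. poly P x * poly R x \<partial>\<mu>) = 0"
  shows "card {x. poly P x = 0} = degree P" "n \<le> degree P"
proof -
  define Z where "Z = {x. odd (order x P)}"
  have Zroots: "Z \<subseteq> {x. poly P x = 0}"
    unfolding Z_def using order_root P(1) by fastforce
  have fin: "finite Z" using Zroots poly_roots_finite[OF P(1)] finite_subset by blast
  \<comment> \<open>\<open>R\<close> changes sign exactly where \<open>P\<close> does, so every root
    of \<open>P * R\<close> has even order.\<close>
  define R where "R = (\<Prod>z\<in>Z. [:-z,1:])"
  have R0: "R \<noteq> 0" unfolding R_def using fin by (rule linear_factors_nonzero)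
  have degR: "degree R = card Z" unfolding R_def by (subst degree_prod_eq_sum_degree) auto
  have ordR: "order x R = (if x \<in> Z then 1 else 0)" for x
    unfolding R_def using fin by (rule order_linear_factors)
  have "\<not> card Z < n"
  proof
    assume "card Z < n"
    then have int0: "(\<integral>x. poly (P * R) x \<partial>\<mu>) = 0" using orth[of R] degR by simp
    have PR0: "P * R \<noteq> 0" using P(1) R0 by simp
    have "even (order x (P * R))" for x
      using PR0 by (simp add: order_mult ordR Z_def)
    from poly_constant_sign_if_even_order[OF PR0 this]
    consider "\<forall>x. 0 \<le> poly (P * R) x" | "\<forall>x. 0 \<le> poly (- (P * R)) x" by auto
    then show False
    proof cases
      case 1
      then show False using integral_poly_nonneg_zeroD[of "P * R"] int0 PR0 by blast
    next
      case 2
      then show False using integral_poly_nonneg_zeroD[of "- (P * R)"] int0 PR0 by simp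
    qed
  qed
  have Rdvd: "R dvd P" unfolding R_def
    using fin Zroots by (rule linear_factors_dvd)
  then obtain T where T: "P = R * T" by blast
  have T0: "T \<noteq> 0" using T P(1) by auto
  have degP: "degree P = card Z + degree T" unfolding T using R0 T0 degR by (simp add: degree_mult_eq)
  \<comment> \<open>The cofactor of \<open>R\<close> has degree at most one. If it were linear, its
    zero \<open>y\<close> would have order 2 in \<open>P\<close> when \<open>y\<close> is in
    \<open>Z\<close> and order 1 otherwise, against the definition of \<open>Z\<close> by odd
    orders.\<close>
  have "degree T = 0"
  proof (rule ccontr)
    assume "degree T \<noteq> 0"
    then have "degree T = 1" using degP P(2) \<open>\<not> card Z < n\<close> by linarith
    then obtain u v where uv: "T = [:u,v:]" "v \<noteq> 0"
      by (elim degree1_coeffs)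
    define y where "y = - u / v"
    have "T = smult v [:-y,1:]" using uv by (simp add: y_def)
    then have "order y T = 1" using uv(2) by (simp add: order_smult order_power_n_n[of _ 1, simplified] del: smult_pCons)
    then have "order y P = order y R + 1" unfolding T using R0 T0 by (simp add: order_mult)
    then show False using ordR[of y] by (auto simp: Z_def split: if_splits)
  qed
  then have degPZ: "degree P = card Z" using degP by simp
  then show "n \<le> degree P" using \<open>\<not> card Z < n\<close> by simp
  have "card Z \<le> card {x. poly P x = 0}" by (intro card_mono Zroots poly_roots_finite P)
  moreover have "card {x. poly P x = 0} \<le> degree P" by (rule card_poly_roots_bound[OF P(1)])
  ultimately show "card {x. poly P x = 0} = degree P" using degPZ by simp
qed

text \<open>The nodes are the zeros of \<open>P\<close>, the weights are the integrals of the
  Lagrange basis polynomials. Division by \<open>P\<close> gives exactness: the quotient has degree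
  below \<open>n\<close>, so its product with \<open>P\<close> integrates to zero, and the remainder
  is interpolated exactly.\<close>

lemma gauss_quadrature:
  assumes P: "P \<noteq> 0" "degree P \<le> Suc n" "0 < n"
    and orth: "\<And>R. degree R < n \<Longrightarrow> (\<integral>x. poly P x * poly R x \<partial>\<mu>) = 0"
  obtains \<sigma> where "real_distribution \<sigma>" "\<And>f::real \<Rightarrow> real. f \<in> borel_measurable borel \<Longrightarrow> integrable \<sigma> f"
    "\<And>q :: real poly. degree q < degree P + n \<Longrightarrow> (\<integral>x. poly q x \<partial>\<sigma>) = (\<integral>x. poly q x \<partial>\<mu>)"
    "AE x in \<sigma>. poly P x = 0"
proof -
  define Z where "Z = {x. poly P x = 0}"
  have cardZ: "card Z = degree P" and degP: "n \<le> degree P"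
    using quasi_orthogonal_roots[OF P(1,2) orth] by (auto simp: Z_def)
  have fin: "finite Z" unfolding Z_def by (rule poly_roots_finite[OF P(1)])
  \<comment> \<open>Lagrange basis: \<open>l z\<close> is 1 at the node \<open>z\<close> and 0 at
    the others.\<close>
  define l where "l z = smult (1 / (\<Prod>y\<in>Z-{z}. z - y)) (\<Prod>y\<in>Z-{z}. [:-y,1:])" for z
  define w where "w z = (\<integral>x. poly (l z) x \<partial>\<mu>)" for z
  have l_eval: "poly (l z) y = (if y = z then 1 else 0)" if "z \<in> Z" "y \<in> Z" for z y
    using that fin by (auto simp: l_def poly_prod)
  have l_deg: "degree (l z) \<le> card Z - 1" if "z \<in> Z" for z
    unfolding l_def using that fin
    by (intro order.trans[OF degree_smult_le]) (subst degree_prod_eq_sum_degree, auto simp: card_Diff_singleton)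
  have Z_pos: "0 < card Z" using cardZ degP P(3) by simp
  have interp: "r = (\<Sum>z\<in>Z. smult (poly r z) (l z))" if "degree r < card Z" for r
  proof (rule ccontr)
    define D where "D = r - (\<Sum>z\<in>Z. smult (poly r z) (l z))"
    assume "r \<noteq> (\<Sum>z\<in>Z. smult (poly r z) (l z))"
    then have "D \<noteq> 0" by (simp add: D_def)
    have "poly D y = 0" if "y \<in> Z" for y
    proof -
      have "(\<Sum>z\<in>Z. poly r z * poly (l z) y) = (\<Sum>z\<in>Z. if z = y then poly r z else 0)"
        using that by (intro sum.cong) (auto simp: l_eval)
      then show ?thesis using that fin by (simp add: D_def poly_sum)
    qed
    then have "card Z \<le> card {x. poly D x = 0}"
      using poly_roots_finite[OF \<open>D \<noteq> 0\<close>] by (intro card_mono) auto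
    also have "\<dots> \<le> degree D" by (rule card_poly_roots_bound[OF \<open>D \<noteq> 0\<close>])
    also have "\<dots> < card Z" unfolding D_def
    proof (intro degree_diff_less that degree_sum_less Z_pos)
      fix z assume "z \<in> Z"
      then have "degree (smult (poly r z) (l z)) \<le> card Z - 1"
        using l_deg[of z] degree_smult_le order.trans by blast
      then show "degree (smult (poly r z) (l z)) < card Z" using Z_pos by linarith
    qed
    finally show False by simp
  qed
  have exact: "(\<integral>x. poly q x \<partial>\<mu>) = (\<Sum>z\<in>Z. w z * poly q z)" if "degree q < degree P + n" for q
  proof -
    define d r where "d = q div P" and "r = q mod P"
    have q: "q = P * d + r" by (simp add: d_def r_def)
    have deg_r: "degree r < card Z"
      using degree_mod_less[of P q] P(1) Z_pos cardZ by (auto simp: r_def)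
    have deg_d: "degree d < n"
    proof (cases "d = 0")
      case False
      then have "degree P + degree d = degree (q - r)" using P(1) by (simp add: q degree_mult_eq)
      also have "\<dots> < degree P + n" using that deg_r cardZ by (intro degree_diff_less) auto
      finally show ?thesis by simp
    qed (use P(3) in simp)
    have "(\<integral>x. poly q x \<partial>\<mu>) = (\<integral>x. poly P x * poly d x \<partial>\<mu>) + (\<integral>x. poly r x \<partial>\<mu>)"
      unfolding q using integrable_poly_mult[of P d] integrable_poly[of r] by simp
    also have "(\<integral>x. poly P x * poly d x \<partial>\<mu>) = 0" by (rule orth[OF deg_d])
    also have "(\<integral>x. poly r x \<partial>\<mu>) = (\<integral>x. (\<Sum>z\<in>Z. poly r z * poly (l z) x) \<partial>\<mu>)"
      by (subst interp[OF deg_r], rule Bochner_Integration.integral_cong) (simp_all add: poly_sum)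
    also have "\<dots> = (\<Sum>z\<in>Z. poly r z * w z)"
      unfolding w_def using integrable_poly by simp
    also have "\<dots> = (\<Sum>z\<in>Z. w z * poly q z)"
      by (intro sum.cong) (auto simp: q Z_def)
    finally show ?thesis by simp
  qed
  \<comment> \<open>The square of \<open>l z\<close> has degree at most
    \<open>2 * (degree P - 1)\<close>, which is still in the range of exactness because
    \<open>degree P\<close> is at most \<open>n + 1\<close>; so \<open>w z\<close> is the integral
    of a square.\<close>
  have w_nonneg: "0 \<le> w z" if "z \<in> Z" for z
  proof -
    have "degree (l z * l z) \<le> degree (l z) + degree (l z)" by (rule degree_mult_le)
    then have "degree (l z * l z) < degree P + n"
      using l_deg[OF that] P(2,3) degP cardZ by linarith
    then have "(\<integral>x. poly (l z * l z) x \<partial>\<mu>) = (\<Sum>y\<in>Z. w y * poly (l z * l z) y)" by (rule exact)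
    also have "\<dots> = (\<Sum>y\<in>Z. if y = z then w y else 0)"
      using that by (intro sum.cong) (auto simp: l_eval)
    also have "\<dots> = w z" using that fin by simp
    finally have "w z = (\<integral>x. poly (l z * l z) x \<partial>\<mu>)" by simp
    then show ?thesis by simp
  qed
  \<comment> \<open>\<open>N\<close> lives on the finite set \<open>Z\<close>; pushing it forward
    along the identity gives a measure on the Borel sets of the whole line.\<close>
  define N where "N = point_measure Z w"
  define \<sigma> where "\<sigma> = distr N borel (\<lambda>x. x)"
  have meas: "f \<in> measurable N borel" for f :: "real \<Rightarrow> real"
    by (simp add: N_def measurable_point_measure_eq1)
  have int_\<sigma>: "(\<integral>x. f x \<partial>\<sigma>) = (\<Sum>z\<in>Z. w z * f z)" if "f \<in> borel_measurable borel" for f :: "real \<Rightarrow> real"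
    unfolding \<sigma>_def using that fin w_nonneg
    by (subst integral_distr) (auto intro: meas simp: N_def lebesgue_integral_point_measure_finite)
  show thesis
  proof
    have "(\<Sum>z\<in>Z. w z) = 1" using exact[of 1] P(3) prob_space by (simp add: prob_space)
    then have "(\<Sum>z\<in>Z. ennreal (w z)) = 1" using w_nonneg by (simp add: sum_ennreal)
    then have "prob_space N"
      by (intro prob_spaceI) (simp add: N_def space_point_measure emeasure_point_measure_finite fin)
    then show "real_distribution \<sigma>"
      unfolding \<sigma>_def by (auto simp: real_distribution_def real_distribution_axioms_def intro!: prob_space.prob_space_distr meas)
  next
    fix f :: "real \<Rightarrow> real" assume "f \<in> borel_measurable borel"
    then show "integrable \<sigma> f"
      unfolding \<sigma>_def N_def using fin w_nonneg
      by (subst integrable_distr_eq) (auto intro: meas[unfolded N_def] simp: integrable_point_measure_finite)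
  next
    fix q :: "real poly" assume "degree q < degree P + n"
    then show "(\<integral>x. poly q x \<partial>\<sigma>) = (\<integral>x. poly q x \<partial>\<mu>)"
      using exact[of q] int_\<sigma>[OF borel_measurable_poly, of q] by simp
  next
    have "AE x in N. poly P x = 0"
      unfolding N_def by (rule AE_I2) (auto simp: space_point_measure Z_def)
    then show "AE x in \<sigma>. poly P x = 0"
      unfolding \<sigma>_def
      by (subst AE_distr_iff) (auto intro: meas borel_closed finite_imp_closed poly_roots_finite[OF P(1)])
  qed
qed

end

section \<open>Orthogonal polynomials and a quadrature adapted to the resolvent\<close>

text \<open>Induction on \<open>n\<close>: subtracting a suitable multiple of \<open>p n\<close>
  removes the coefficient of degree \<open>n\<close>.\<close>

lemma poly_expansion:
  fixes p :: "nat \<Rightarrow> real poly"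
  assumes "\<And>i. degree (p i) = i" "\<And>i. p i \<noteq> 0" "degree R \<le> n"
  obtains c where "R = (\<Sum>i\<le>n. smult (c i) (p i))"
proof -
  have "\<exists>c. R = (\<Sum>i\<le>n. smult (c i) (p i))"
    using assms(3)
  proof (induction n arbitrary: R)
    case 0
    obtain r where r: "R = [:r:]" using 0 degree0_coeffs by blast
    obtain s where s: "p 0 = [:s:]" using assms(1)[of 0] degree0_coeffs by blast
    have "s \<noteq> 0" using s assms(2)[of 0] by auto
    then show ?case by (intro exI[of _ "\<lambda>_. r / s"]) (simp add: r s)
  next
    case (Suc n)
    define k where "k = coeff R (Suc n) / coeff (p (Suc n)) (Suc n)"
    have lc: "coeff (p (Suc n)) (Suc n) \<noteq> 0"
      using assms(1,2)[of "Suc n"] by (metis leading_coeff_0_iff)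
    have "degree (R - smult k (p (Suc n))) \<le> n"
    proof (intro degree_le allI impI)
      fix i assume "n < i"
      then consider "i = Suc n" | "Suc n < i" by linarith
      then show "coeff (R - smult k (p (Suc n))) i = 0"
        using Suc.prems lc assms(1)[of "Suc n"] by cases (auto simp: k_def coeff_eq_0)
    qed
    from Suc.IH[OF this] obtain c where c: "R - smult k (p (Suc n)) = (\<Sum>i\<le>n. smult (c i) (p i))" by blast
    have "R = (\<Sum>i\<le>Suc n. smult ((c(Suc n := k)) i) (p i))"
      using c by (simp add: algebra_simps)
    then show ?case by blast
  qed
  then show thesis using that by blast
qed

locale orthogonal_polynomials = moment_distribution +
  fixes p :: "nat \<Rightarrow> real poly"
  assumes deg_p: "\<And>i. degree (p i) = i"
    and p_nonzero: "\<And>i. p i \<noteq> 0"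
    and orth_p: "\<And>i j. i \<noteq> j \<Longrightarrow> (\<integral>x. poly (p i) x * poly (p j) x \<partial>\<mu>) = 0"
begin

lemma orth_lower_degree:
  assumes "degree R < n"
  shows "(\<integral>x. poly (p n) x * poly R x \<partial>\<mu>) = 0"
proof -
  obtain c where c: "R = (\<Sum>i\<le>degree R. smult (c i) (p i))"
    by (rule poly_expansion[OF deg_p p_nonzero order.refl])
  have int: "integrable \<mu> (\<lambda>x. poly (p n) x * poly (p i) x)" for i
    by (rule integrable_poly_mult)
  have "(\<integral>x. poly (p n) x * poly R x \<partial>\<mu>) = (\<integral>x. (\<Sum>i\<le>degree R. c i * (poly (p n) x * poly (p i) x)) \<partial>\<mu>)"
    by (subst c) (simp add: poly_sum sum_distrib_left mult_ac)
  also have "\<dots> = (\<Sum>i\<le>degree R. c i * (\<integral>x. poly (p n) x * poly (p i) x \<partial>\<mu>))"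
    using int by simp
  also have "\<dots> = 0" using assms orth_p by (intro sum.neutral) auto
  finally show ?thesis .
qed

text \<open>The polynomial \<open>P = (x - a)/b + Q S\<close>, \<open>Q = (x - a)\<^sup>2 + b\<^sup>2\<close>, is a combination of two consecutive
  orthogonal polynomials that takes the value \<open>i\<close> at \<open>z = a + i b\<close>. So \<open>(P\<^sup>2 + 1) / Q\<close> is a
  polynomial, to which the quadrature at the zeros of \<open>P\<close> applies.\<close>

lemma resolvent_quadrature:
  assumes b: "0 < b" and n: "0 < n"
  obtains \<sigma> S where "real_distribution \<sigma>"
    "\<And>k. k < 2 * n \<Longrightarrow> integrable \<sigma> (\<lambda>x. x ^ k)"
    "\<And>k. k < 2 * n \<Longrightarrow> (\<integral>x. x ^ k \<partial>\<sigma>) = (\<integral>x. x ^ k \<partial>\<mu>)"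
    "(\<integral>x. 1 / ((x - a)\<^sup>2 + b\<^sup>2) \<partial>\<sigma>) = (\<integral>x. 1 / ((x - a)\<^sup>2 + b\<^sup>2) \<partial>\<mu>)
       + (\<integral>x. ((x - a) / b + ((x - a)\<^sup>2 + b\<^sup>2) * poly S x)\<^sup>2 / ((x - a)\<^sup>2 + b\<^sup>2) \<partial>\<mu>)"
proof -
  define Q where "Q = [:a\<^sup>2 + b\<^sup>2, -2 * a, 1:]"
  have Q_eval: "poly Q x = (x - a)\<^sup>2 + b\<^sup>2" for x by (simp add: Q_def power2_eq_square algebra_simps)
  have Q_pos: "0 < poly Q x" for x unfolding Q_eval using b by (simp add: add_nonneg_pos)
  have Q0: "Q \<noteq> 0" and degQ: "degree Q = 2" by (auto simp: Q_def)
  \<comment> \<open>The remainder modulo \<open>Q\<close> is affine and agrees with \<open>q\<close>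
    at z = a + i b, so \<open>r q\<close> is the real part of q(z).\<close>
  define r where "r q = poly (q mod Q) a" for q
  \<comment> \<open>The weights make the value of \<open>P0\<close> at z purely imaginary. If both
    real parts vanish already, \<open>A = 1\<close> and \<open>B = 0\<close> prevent the trivial
    combination.\<close>
  define A B where "A = (if r (p n) = 0 \<and> r (p (Suc n)) = 0 then 1 else r (p n))"
    and "B = - r (p (Suc n))"
  define P0 where "P0 = smult A (p (Suc n)) + smult B (p n)"
  have P0_0: "P0 \<noteq> 0"
  proof (cases "A = 0")
    case True
    then show ?thesis using p_nonzero[of n] by (auto simp: P0_def A_def B_def split: if_splits)
  next
    case False
    then have "coeff P0 (Suc n) = A * lead_coeff (p (Suc n))"
      by (simp add: P0_def deg_p coeff_eq_0)
    then show ?thesis using False p_nonzero[of "Suc n"] by auto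
  qed
  have P0_deg: "degree P0 \<le> Suc n"
    unfolding P0_def by (intro degree_add_le order.trans[OF degree_smult_le]) (auto simp: deg_p)
  have P0_orth: "(\<integral>x. poly P0 x * poly R x \<partial>\<mu>) = 0" if "degree R < n" for R
  proof -
    have "(\<integral>x. poly P0 x * poly R x \<partial>\<mu>) =
        (\<integral>x. A * poly (p (Suc n) * R) x + B * poly (p n * R) x \<partial>\<mu>)"
      by (simp add: P0_def algebra_simps)
    also have "\<dots> = A * (\<integral>x. poly (p (Suc n) * R) x \<partial>\<mu>) + B * (\<integral>x. poly (p n * R) x \<partial>\<mu>)"
      using integrable_poly_mult by simp
    also have "\<dots> = 0" using that orth_lower_degree[of R n] orth_lower_degree[of R "Suc n"] by simp
    finally show ?thesis .
  qed
  have "r P0 = A * r (p (Suc n)) + B * r (p n)"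
    by (simp add: r_def P0_def poly_mod_add_left mod_smult_left)
  then have "r P0 = 0" by (auto simp: A_def B_def)
  have "degree (P0 mod Q) < 2" using degree_mod_less[OF Q0, of P0] degQ by auto
  then obtain u v where uv: "P0 mod Q = [:u, v:]"
    by (metis One_nat_def degree_pCons_eq_if less_2_cases pCons_cases degree0_coeffs degree1_coeffs pCons_0_0)
  define k where "k = v"
  have P0_mod: "P0 mod Q = smult k [:-a, 1:]"
    using \<open>r P0 = 0\<close> uv by (simp add: r_def k_def algebra_simps)
  \<comment> \<open>The value of \<open>P0\<close> at z is i k b. If it were zero, \<open>P0\<close>
    would have a pair of nonreal zeros, although it has as many real zeros as its degree.\<close>
  have "k \<noteq> 0"
  proof
    assume "k = 0"
    then have "Q dvd P0" using P0_mod by (simp add: mod_eq_0_iff_dvd)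
    then obtain T where T: "P0 = Q * T" by blast
    have T0: "T \<noteq> 0" using T P0_0 by auto
    have "{x. poly P0 x = 0} = {x. poly T x = 0}" using Q_pos by (auto simp: T less_le)
    moreover have "card {x. poly P0 x = 0} = degree P0"
      by (rule quasi_orthogonal_roots(1)[OF P0_0 P0_deg P0_orth])
    moreover have "degree P0 = 2 + degree T" using T Q0 T0 degQ by (simp add: degree_mult_eq)
    ultimately show False using card_poly_roots_bound[OF T0] by simp
  qed
  \<comment> \<open>Division by \<open>k * b\<close> normalises the value at z to i.\<close>
  define S where "S = smult (1 / (k * b)) (P0 div Q)"
  define P where "P = smult (1 / b) [:-a, 1:] + Q * S"
  have "P = smult (1 / (k * b)) (P0 mod Q + Q * (P0 div Q))"
    using \<open>k \<noteq> 0\<close> unfolding P_def P0_mod S_def smult_add_right mult_smult_right smult_smult by simp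
  then have P_P0: "P = smult (1 / (k * b)) P0" by simp
  have P0': "P \<noteq> 0" and P_deg: "degree P \<le> Suc n"
    using P0_0 P0_deg \<open>k \<noteq> 0\<close> b unfolding P_P0 by auto
  have P_orth: "(\<integral>x. poly P x * poly R x \<partial>\<mu>) = 0" if "degree R < n" for R
    unfolding P_P0 using P0_orth[OF that] by (simp add: mult.assoc)
  have n_le: "n \<le> degree P" by (rule quasi_orthogonal_roots(2)[OF P0' P_deg P_orth])
  obtain \<sigma> where \<sigma>: "real_distribution \<sigma>" "\<And>f::real \<Rightarrow> real. f \<in> borel_measurable borel \<Longrightarrow> integrable \<sigma> f"
    "\<And>q :: real poly. degree q < degree P + n \<Longrightarrow> (\<integral>x. poly q x \<partial>\<sigma>) = (\<integral>x. poly q x \<partial>\<mu>)"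
    "AE x in \<sigma>. poly P x = 0"
    using gauss_quadrature[OF P0' P_deg n P_orth] by blast
  interpret \<sigma>: real_distribution \<sigma> by (rule \<sigma>(1))
  \<comment> \<open>This is \<open>(P^2 + 1) / Q\<close> written out, by means of
    \<open>((x - a) / b)^2 + 1 = Q / b^2\<close>. At the zeros of \<open>P\<close> it coincides with
    \<open>1 / Q\<close>.\<close>
  define q where "q = [:1 / b\<^sup>2:] + smult (2 / b) ([:-a, 1:] * S) + Q * S\<^sup>2"
  have q_eval: "poly Q x * poly q x = (poly P x)\<^sup>2 + 1" for x
  proof -
    have "(x - a)\<^sup>2 = poly Q x - b\<^sup>2" by (simp add: Q_eval)
    then have "((x - a) / b)\<^sup>2 + 1 = poly Q x / b\<^sup>2" using b by (simp add: field_simps)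
    moreover have "poly P x = (x - a) / b + poly Q x * poly S x" by (simp add: P_def diff_divide_distrib)
    moreover have "poly q x = 1 / b\<^sup>2 + 2 * ((x - a) / b) * poly S x + poly Q x * (poly S x)\<^sup>2"
      by (simp add: q_def poly_power field_simps)
    ultimately show ?thesis by (simp add: power2_eq_square algebra_simps)
  qed
  have q_eq: "poly q x = 1 / poly Q x + (poly P x)\<^sup>2 / poly Q x" for x
    using q_eval[of x] Q_pos[of x] by (simp add: field_simps)
  have q0: "q \<noteq> 0" using q_eq[of 0] Q_pos[of 0] by (auto simp: add_pos_nonneg less_imp_neq field_simps sum_power2_eq_zero_iff)
  have "Q * q = P\<^sup>2 + 1" using q_eval by (intro poly_eq_poly_eq_iff[THEN iffD1] ext) (simp add: poly_power)
  moreover have "degree (Q * q) = 2 + degree q" using Q0 q0 degQ by (simp add: degree_mult_eq)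
  moreover have "degree (P\<^sup>2 + 1) \<le> 2 * degree P"
    using P0' by (intro degree_add_le) (auto simp: degree_power_eq)
  ultimately have "2 + degree q \<le> 2 * degree P" by simp
  \<comment> \<open>The degree of \<open>q\<close> is at most \<open>2 * degree P - 2\<close>, and
    \<open>degree P\<close> is at most \<open>n + 1\<close>.\<close>
  then have q_deg: "degree q < degree P + n" using P_deg n by linarith
  have Q_cont: "continuous_on UNIV (\<lambda>x. 1 / poly Q x)"
    by (intro continuous_intros) (use Q_pos in \<open>auto simp: less_le\<close>)
  then have Q_meas[measurable]: "(\<lambda>x. 1 / poly Q x) \<in> borel_measurable borel"
    by (rule borel_measurable_continuous_onI)
  have "0 \<le> 1 / poly Q x" "1 / poly Q x \<le> 1 / b\<^sup>2" for x
    using Q_pos[of x] b by (auto simp: Q_eval intro!: divide_left_mono mult_pos_pos add_nonneg_pos)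
  then have Q_int: "integrable \<mu> (\<lambda>x. 1 / poly Q x)"
    by (intro integrable_const_bound[of _ "1 / b\<^sup>2"]) auto
  have "(\<lambda>x. (poly P x)\<^sup>2 / poly Q x) = (\<lambda>x. poly q x - 1 / poly Q x)" using q_eq by auto
  then have PQ_int: "integrable \<mu> (\<lambda>x. (poly P x)\<^sup>2 / poly Q x)"
    using integrable_poly[of q] Q_int by simp
  have "(\<integral>x. 1 / poly Q x \<partial>\<sigma>) = (\<integral>x. poly q x \<partial>\<sigma>)"
  proof (rule integral_cong_AE)
    show "AE x in \<sigma>. 1 / poly Q x = poly q x"
      using \<sigma>(4) by eventually_elim (simp add: q_eq)
    show "(\<lambda>x. 1 / poly Q x) \<in> borel_measurable \<sigma>"
      using Q_meas unfolding measurable_cong_sets[OF \<sigma>.events_eq_borel refl] .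
    show "(\<lambda>x. poly q x) \<in> borel_measurable \<sigma>"
      unfolding measurable_cong_sets[OF \<sigma>.events_eq_borel refl] by (rule borel_measurable_poly)
  qed
  also have "\<dots> = (\<integral>x. poly q x \<partial>\<mu>)" by (rule \<sigma>(3)[OF q_deg])
  also have "\<dots> = (\<integral>x. 1 / poly Q x \<partial>\<mu>) + (\<integral>x. (poly P x)\<^sup>2 / poly Q x \<partial>\<mu>)"
    unfolding q_eq using Q_int PQ_int by simp
  finally have res: "(\<integral>x. 1 / poly Q x \<partial>\<sigma>) = (\<integral>x. 1 / poly Q x \<partial>\<mu>) + (\<integral>x. (poly P x)\<^sup>2 / poly Q x \<partial>\<mu>)" .
  show thesis
  proof
    show "real_distribution \<sigma>" by (rule \<sigma>(1))
    show "integrable \<sigma> (\<lambda>x. x ^ k)" for k by (rule \<sigma>(2)) measurable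
    fix k assume "k < 2 * n"
    then have "degree (monom (1::real) k) < degree P + n" using n_le degree_monom_le[of "1::real" k] by linarith
    from \<sigma>(3)[OF this] show "(\<integral>x. x ^ k \<partial>\<sigma>) = (\<integral>x. x ^ k \<partial>\<mu>)" by (simp add: poly_monom)
  next
    show "(\<integral>x. 1 / ((x - a)\<^sup>2 + b\<^sup>2) \<partial>\<sigma>) = (\<integral>x. 1 / ((x - a)\<^sup>2 + b\<^sup>2) \<partial>\<mu>)
       + (\<integral>x. ((x - a) / b + ((x - a)\<^sup>2 + b\<^sup>2) * poly S x)\<^sup>2 / ((x - a)\<^sup>2 + b\<^sup>2) \<partial>\<mu>)"
      using res by (simp add: Q_eval P_def diff_divide_distrib)
  qed
qed

end

section \<open>Weak limits of measures with prescribed moments\<close>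

text \<open>Only points with absolute value above \<open>C\<close> contribute, and there an extra
  factor \<open>(\<bar>x\<bar> / C) ^ k\<close> is at least 1. The bound turns a moment of order
  \<open>2 * k\<close> into a truncation error for the moment of order \<open>k\<close>.\<close>

lemma clamp_power_error:
  fixes x C :: real
  assumes "0 < C"
  shows "\<bar>x ^ k - (max (- C) (min C x)) ^ k\<bar> \<le> x ^ (2 * k) / C ^ k"
proof (cases "\<bar>x\<bar> \<le> C")
  case True
  then have "max (- C) (min C x) = x" by auto
  then show ?thesis using assms by simp
next
  case False
  define y where "y = max (- C) (min C x)"
  have y: "y = sgn x * C" using False assms by (auto simp: y_def sgn_if max_def min_def abs_if split: if_splits)
  have x: "x = sgn x * \<bar>x\<bar>" by (simp add: sgn_mult_abs)
  have sgn1: "\<bar>sgn x\<bar> = 1" using False assms by (auto simp: sgn_if)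
  have "x ^ k - y ^ k = (sgn x) ^ k * (\<bar>x\<bar> ^ k - C ^ k)"
    unfolding y by (subst x) (simp only: power_mult_distrib right_diff_distrib)
  then have "\<bar>x ^ k - y ^ k\<bar> = \<bar>\<bar>x\<bar> ^ k - C ^ k\<bar>" using sgn1 by (simp add: abs_mult power_abs)
  also have "\<dots> \<le> \<bar>x\<bar> ^ k" using False assms power_mono[of C "\<bar>x\<bar>" k] by simp
  also have "\<dots> \<le> \<bar>x\<bar> ^ k * (\<bar>x\<bar> ^ k / C ^ k)"
  proof -
    have "1 \<le> \<bar>x\<bar> ^ k / C ^ k" using False assms power_mono[of C "\<bar>x\<bar>" k] by simp
    from mult_left_mono[OF this, of "\<bar>x\<bar> ^ k"] show ?thesis by simp
  qed
  also have "\<dots> = x ^ (2 * k) / C ^ k" by (simp add: power_mult power_mult_distrib flip: power_add mult_2)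
  finally show ?thesis by (simp add: y_def)
qed

lemma integrable_power_if_even_power:
  fixes \<nu> :: "real measure"
  assumes "real_distribution \<nu>" "integrable \<nu> (\<lambda>x. x ^ (2 * k))"
  shows "integrable \<nu> (\<lambda>x. x ^ k)"
proof -
  interpret real_distribution \<nu> by fact
  show ?thesis
  proof (rule Bochner_Integration.integrable_bound)
    show "integrable \<nu> (\<lambda>x. 1 + x ^ (2 * k))" using assms(2) by simp
    have "\<bar>x ^ k\<bar> \<le> 1 + x ^ (2 * k)" for x :: real
    proof -
      have "0 \<le> (\<bar>x ^ k\<bar> - 1)\<^sup>2" by simp
      then show ?thesis by (simp add: power2_diff power_mult[symmetric] mult.commute)
    qed
    then show "AE x in \<nu>. norm (x ^ k) \<le> norm (1 + x ^ (2 * k))" by simp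
  qed simp
qed

text \<open>Method of moments: common second moments give tightness, tightness gives a weak limit,
  and truncation errors that are uniform in \<open>n\<close> carry each moment to the limit. The
  offset in \<open>n + 2\<close> makes the second moment available for every
  \<open>n\<close>.\<close>

lemma subsequence_with_limit_moments:
  fixes \<sigma> :: "nat \<Rightarrow> real measure" and m :: "nat \<Rightarrow> real"
  assumes rd: "\<And>n. real_distribution (\<sigma> n)"
    and int: "\<And>n k. k \<le> n + 2 \<Longrightarrow> integrable (\<sigma> n) (\<lambda>x. x ^ k)"
    and mom: "\<And>n k. k \<le> n + 2 \<Longrightarrow> (\<integral>x. x ^ k \<partial>\<sigma> n) = m k"
  obtains r \<nu> where "strict_mono (r :: nat \<Rightarrow> nat)" "real_distribution \<nu>" "weak_conv_m (\<sigma> \<circ> r) \<nu>"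
    "\<And>k. integrable \<nu> (\<lambda>x. x ^ k)" "\<And>k. (\<integral>x. x ^ k \<partial>\<nu>) = m k"
proof -
  interpret \<sigma>: real_distribution "\<sigma> n" for n by (rule rd)
  have m_even: "0 \<le> m (2 * k)" for k
    using mom[of "2 * k" "2 * k"] by (metis Bochner_Integration.integral_nonneg le_add1 power_mult zero_le_even_power' zero_le_power2 zero_le_power)
  have "tight \<sigma>"
    unfolding tight_def
  proof (intro conjI allI impI rd)
    fix e :: real assume e: "0 < e"
    \<comment> \<open>With this choice \<open>m 2 < C * e\<close> and \<open>C\<close> is at most
      its square, so Chebyshev's inequality bounds the mass outside \<open>{-C<..C}\<close> by less
      than \<open>e\<close>.\<close>
    define C where "C = m 2 / e + 1"
    have C1: "1 \<le> C" using m_even[of 1] e by (simp add: C_def)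
    have "1 - e < measure (\<sigma> n) {-C<..C}" for n
    proof -
      have int2: "integrable (\<sigma> n) (\<lambda>x. x\<^sup>2)" by (rule int) simp
      have "measure (\<sigma> n) {x \<in> space (\<sigma> n). C\<^sup>2 \<le> x\<^sup>2} \<le> (\<integral>x. x\<^sup>2 \<partial>\<sigma> n) / C\<^sup>2"
        using C1 by (intro integral_Markov_inequality_measure[where A = "space (\<sigma> n)"] int2) auto
      also have "(\<integral>x. x\<^sup>2 \<partial>\<sigma> n) = m 2" by (rule mom) simp
      also have "m 2 / C\<^sup>2 < e"
      proof -
        have "C \<le> C\<^sup>2" using C1 by (simp add: power2_eq_square)
        moreover have "m 2 < C * e" using e by (simp add: C_def field_simps)
        ultimately have "m 2 < C\<^sup>2 * e" using e by (meson mult_right_mono less_imp_le order_less_le_trans)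
        then show ?thesis using C1 by (simp add: field_simps)
      qed
      finally have small: "measure (\<sigma> n) {x \<in> space (\<sigma> n). C\<^sup>2 \<le> x\<^sup>2} < e" .
      have "space (\<sigma> n) - {-C<..C} \<subseteq> {x \<in> space (\<sigma> n). C\<^sup>2 \<le> x\<^sup>2}"
        using C1 by (auto simp: abs_le_square_iff[symmetric])
      then have "measure (\<sigma> n) (space (\<sigma> n) - {-C<..C}) \<le> measure (\<sigma> n) {x \<in> space (\<sigma> n). C\<^sup>2 \<le> x\<^sup>2}"
        by (intro \<sigma>.finite_measure_mono) auto
      then show ?thesis using small \<sigma>.prob_compl[of "{-C<..C}" n] by simp
    qed
    then show "\<exists>a b. a < b \<and> (\<forall>n. 1 - e < measure (\<sigma> n) {a<..b})"
      using C1 by (intro exI[of _ "-C"] exI[of _ C]) auto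
  qed
  then obtain r \<nu> where r: "strict_mono (r :: nat \<Rightarrow> nat)" and \<nu>: "real_distribution \<nu>"
    and conv: "weak_conv_m (\<sigma> \<circ> r) \<nu>"
    using tight_imp_convergent_subsubsequence[of \<sigma> "\<lambda>n. n"] by (auto simp: strict_mono_def o_def)
  interpret \<nu>: real_distribution \<nu> by (rule \<nu>)
  have rd': "real_distribution ((\<sigma> \<circ> r) n)" for n using rd by simp
  have lim: "(\<lambda>n. \<integral>x. f x \<partial>\<sigma> (r n)) \<longlonglongrightarrow> (\<integral>x. f x \<partial>\<nu>)"
    if "\<And>x. isCont f x" "\<And>x. norm (f x) \<le> B" for f :: "real \<Rightarrow> real" and B
    using weak_conv_imp_integral_bdd_continuous_conv[OF rd' \<nu> conv that] by simp
  have r_ge: "n \<le> r n" for n using r by (rule strict_mono_imp_increasing)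
  \<comment> \<open>An inequality for even moments suffices at first: it controls the truncation
    error under the limit law. It follows from weak convergence for the truncated powers and
    monotone convergence in the truncation level.\<close>
  have even_bound: "integrable \<nu> (\<lambda>x. x ^ (2 * k)) \<and> (\<integral>x. x ^ (2 * k) \<partial>\<nu>) \<le> m (2 * k)" for k
  proof -
    define h where "h i x = (min (real i) \<bar>x\<bar>) ^ (2 * k)" for i x
    have h_bd: "norm (h i x) \<le> real i ^ (2 * k)" for i x
      by (auto simp: h_def intro!: power_mono)
    have h_cont: "isCont (h i) x" for i x
      unfolding h_def by (intro continuous_intros)
    have h_meas: "h i \<in> borel_measurable borel" for i unfolding h_def by measurable
    have h_le: "h i x \<le> x ^ (2 * k)" for i x
    proof -
      have "h i x \<le> \<bar>x\<bar> ^ (2 * k)" unfolding h_def by (intro power_mono) auto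
      then show ?thesis by (simp add: power_even_abs)
    qed
    have h_int: "integrable \<rho> (h i)" if "real_distribution \<rho>" for i \<rho>
    proof -
      interpret \<rho>: real_distribution \<rho> by (rule that)
      show ?thesis using h_bd h_meas by (intro \<rho>.integrable_const_bound[of _ "real i ^ (2 * k)"]) auto
    qed
    have h_lim_le: "(\<integral>x. h i x \<partial>\<nu>) \<le> m (2 * k)" for i
    proof (rule LIMSEQ_le_const2[OF lim[OF h_cont h_bd]], intro exI[of _ "2 * k"] allI impI)
      fix n assume "2 * k \<le> n"
      then have n: "2 * k \<le> r n + 2" using r_ge[of n] by linarith
      have "(\<integral>x. h i x \<partial>\<sigma> (r n)) \<le> (\<integral>x. x ^ (2 * k) \<partial>\<sigma> (r n))"
        using h_le by (intro integral_mono h_int rd int[OF n])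
      then show "(\<integral>x. h i x \<partial>\<sigma> (r n)) \<le> m (2 * k)" using mom[OF n] by simp
    qed
    have h_mono: "mono (\<lambda>i. h i x)" for x
      unfolding h_def by (intro monoI power_mono) auto
    have h_lim: "(\<lambda>i. h i x) \<longlonglongrightarrow> x ^ (2 * k)" for x
    proof (rule tendsto_eventually)
      obtain N where "\<bar>x\<bar> \<le> real N" using real_arch_simple by blast
      then show "\<forall>\<^sub>F i in sequentially. h i x = x ^ (2 * k)"
        by (intro eventually_sequentiallyI[of N]) (simp add: h_def min_absorb2 power_even_abs)
    qed
    have "mono (\<lambda>i. \<integral>x. h i x \<partial>\<nu>)"
      using h_int[OF \<nu>] h_mono by (intro monoI integral_mono) (auto simp: mono_def)
    then obtain L where L: "(\<lambda>i. \<integral>x. h i x \<partial>\<nu>) \<longlonglongrightarrow> L"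
      by (rule incseq_convergent[of _ "m (2 * k)"]) (use h_lim_le in auto)
    have meas: "(\<lambda>x. x ^ (2 * k)) \<in> borel_measurable \<nu>" by measurable
    have "integrable \<nu> (\<lambda>x. x ^ (2 * k))" "(\<integral>x. x ^ (2 * k) \<partial>\<nu>) = L"
      using integrable_monotone_convergence[OF h_int[OF \<nu>] _ _ L meas]
        integral_monotone_convergence[OF h_int[OF \<nu>] _ _ L meas] h_mono h_lim by auto
    moreover have "L \<le> m (2 * k)" by (rule LIMSEQ_le_const2[OF L]) (use h_lim_le in blast)
    ultimately show ?thesis by simp
  qed
  have \<nu>_int: "integrable \<nu> (\<lambda>x. x ^ k)" for k
    using integrable_power_if_even_power[OF \<nu>] even_bound by blast
  have "(\<integral>x. x ^ k \<partial>\<nu>) = m k" for k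
  proof (cases "k = 0")
    case True
    then show ?thesis using mom[of 0 0] \<sigma>.prob_space[of 0] \<nu>.prob_space by simp
  next
    case False
    \<comment> \<open>One truncation error comes from the approximating laws, one from the limit. As
      \<open>k\<close> is positive, \<open>C ^ k\<close> is at least \<open>C\<close>, and the bound
      vanishes as \<open>C\<close> grows.\<close>
    have bound: "\<bar>m k - (\<integral>x. x ^ k \<partial>\<nu>)\<bar> \<le> 2 * m (2 * k) / C" if C: "1 \<le> C" for C
    proof -
      define g where "g x = (max (- C) (min C x)) ^ k" for x
      have g_cont: "isCont g x" for x unfolding g_def by (intro continuous_intros)
      have g_bd: "norm (g x) \<le> C ^ k" for x
        using C by (auto simp: g_def power_abs intro!: power_mono)
      have g_meas: "g \<in> borel_measurable borel" unfolding g_def by measurable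
      have err: "\<bar>(\<integral>x. x ^ k \<partial>\<rho>) - (\<integral>x. g x \<partial>\<rho>)\<bar> \<le> m (2 * k) / C ^ k"
        if \<rho>: "real_distribution \<rho>" "integrable \<rho> (\<lambda>x. x ^ (2 * k))" "(\<integral>x. x ^ (2 * k) \<partial>\<rho>) \<le> m (2 * k)" for \<rho>
      proof -
        interpret \<rho>: real_distribution \<rho> by (rule \<rho>(1))
        have ik: "integrable \<rho> (\<lambda>x. x ^ k)" by (rule integrable_power_if_even_power[OF \<rho>(1,2)])
        have ig: "integrable \<rho> g"
          using g_bd g_meas by (intro \<rho>.integrable_const_bound[of _ "C ^ k"]) auto
        have "\<bar>(\<integral>x. x ^ k \<partial>\<rho>) - (\<integral>x. g x \<partial>\<rho>)\<bar> = \<bar>\<integral>x. x ^ k - g x \<partial>\<rho>\<bar>"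
          using ik ig by simp
        also have "\<dots> \<le> (\<integral>x. \<bar>x ^ k - g x\<bar> \<partial>\<rho>)" by (rule integral_abs_bound)
        also have "\<dots> \<le> (\<integral>x. x ^ (2 * k) / C ^ k \<partial>\<rho>)"
        proof (rule integral_mono)
          show "\<bar>x ^ k - g x\<bar> \<le> x ^ (2 * k) / C ^ k" for x
            unfolding g_def using C by (intro clamp_power_error) simp
        qed (use ik ig \<rho>(2) in auto)
        also have "\<dots> \<le> m (2 * k) / C ^ k" using \<rho>(3) C by (simp add: divide_right_mono)
        finally show ?thesis .
      qed
      have "\<bar>m k - (\<integral>x. g x \<partial>\<nu>)\<bar> \<le> m (2 * k) / C ^ k"
      proof (rule LIMSEQ_le_const2)
        show "(\<lambda>n. \<bar>m k - (\<integral>x. g x \<partial>\<sigma> (r n))\<bar>) \<longlonglongrightarrow> \<bar>m k - (\<integral>x. g x \<partial>\<nu>)\<bar>"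
          by (intro tendsto_intros lim[OF g_cont g_bd])
        show "\<exists>N. \<forall>n\<ge>N. \<bar>m k - (\<integral>x. g x \<partial>\<sigma> (r n))\<bar> \<le> m (2 * k) / C ^ k"
        proof (intro exI[of _ "2 * k"] allI impI)
          fix n assume "2 * k \<le> n"
          then have n: "2 * k \<le> r n + 2" "k \<le> r n + 2" using r_ge[of n] by linarith+
          show "\<bar>m k - (\<integral>x. g x \<partial>\<sigma> (r n))\<bar> \<le> m (2 * k) / C ^ k"
            using err[OF rd int[OF n(1)]] mom[OF n(1)] mom[OF n(2)] by simp
        qed
      qed
      moreover have "\<bar>(\<integral>x. x ^ k \<partial>\<nu>) - (\<integral>x. g x \<partial>\<nu>)\<bar> \<le> m (2 * k) / C ^ k"
        using err[OF \<nu>] even_bound by simp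
      ultimately have "\<bar>m k - (\<integral>x. x ^ k \<partial>\<nu>)\<bar> \<le> 2 * m (2 * k) / C ^ k" by linarith
      also have "\<dots> \<le> 2 * m (2 * k) / C"
        using C False m_even[of k] self_le_power[of C k] by (intro divide_left_mono) auto
      finally show ?thesis .
    qed
    have "((\<lambda>C. 2 * m (2 * k) / C) \<longlongrightarrow> 0) at_top" by (rule real_tendsto_divide_at_top[OF tendsto_const filterlim_ident])
    moreover have "\<forall>\<^sub>F C in at_top. \<bar>m k - (\<integral>x. x ^ k \<partial>\<nu>)\<bar> \<le> 2 * m (2 * k) / C"
      using eventually_ge_at_top[of 1] by eventually_elim (rule bound)
    ultimately have "\<bar>m k - (\<integral>x. x ^ k \<partial>\<nu>)\<bar> \<le> 0"
      by (intro tendsto_lowerbound) auto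
    then show ?thesis by simp
  qed
  with r \<nu> conv \<nu>_int that show thesis by blast
qed

section \<open>Orthogonality to polynomials under a determinate law\<close>

lemma abs_mult_le_sum_squares: "\<bar>y * z\<bar> \<le> y\<^sup>2 + z\<^sup>2" for y z :: real
proof -
  have "0 \<le> (\<bar>y\<bar> - \<bar>z\<bar>)\<^sup>2" "0 \<le> \<bar>y\<bar> * \<bar>z\<bar>" by simp_all
  moreover from this(1) have "2 * (\<bar>y\<bar> * \<bar>z\<bar>) \<le> y\<^sup>2 + z\<^sup>2" unfolding power2_diff by simp
  ultimately show ?thesis unfolding abs_mult by linarith
qed

text \<open>Dynkin's argument: the sets over which \<open>Y\<close> integrates to zero are closed
  under complements, because the total integral is zero, and under countable disjoint
  unions.\<close>

lemma set_integral_zero_sigma_sets: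
  fixes Y :: "'a \<Rightarrow> real"
  assumes Y: "integrable M Y" "(\<integral>x. Y x \<partial>M) = 0"
    and G: "Int_stable G" "G \<subseteq> sets M" "\<And>A. A \<in> G \<Longrightarrow> (\<integral>x\<in>A. Y x \<partial>M) = 0"
    and A: "A \<in> sigma_sets (space M) G"
  shows "(\<integral>x\<in>A. Y x \<partial>M) = 0"
proof -
  have G_Pow: "G \<subseteq> Pow (space M)" using G(2) sets.sets_into_space by blast
  have in_M: "A \<in> sets M" if "A \<in> sigma_sets (space M) G" for A
    using that G(2) sets.sigma_sets_subset by blast
  have int: "set_integrable M A Y" if "A \<in> sets M" for A
    unfolding set_integrable_def using Y(1) that by (rule integrable_mult_indicator[rotated])
  show ?thesis using G(1) G_Pow A
  proof (induction rule: sigma_sets_induct_disjoint)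
    case (compl A)
    have "(\<integral>x\<in>space M. Y x \<partial>M) = (\<integral>x\<in>A \<union> (space M - A). Y x \<partial>M)"
      using sets.sets_into_space[OF in_M[OF compl(1)]] by (intro arg_cong[of _ _ "\<lambda>S. \<integral>x\<in>S. Y x \<partial>M"]) auto
    also have "\<dots> = (\<integral>x\<in>A. Y x \<partial>M) + (\<integral>x\<in>space M - A. Y x \<partial>M)"
      using in_M[OF compl(1)] by (intro set_integral_Un int) auto
    finally show ?case using compl(2) Y by (simp add: set_integral_space)
  next
    case (union A)
    have "(\<integral>x\<in>(\<Union>i. A i). Y x \<partial>M) = (\<Sum>i. (\<integral>x\<in>A i. Y x \<partial>M))"
    proof (intro lebesgue_integral_countable_add int)
      show A_M: "A i \<in> sets M" for i using union(2) in_M by blast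
      show "(\<Union>i. A i) \<in> sets M" using A_M by blast
      show "A i \<inter> A j = {}" if "i \<noteq> j" for i j using union(1) that by (simp add: disjoint_family_on_def)
    qed
    then show ?case using union(3) by simp
  qed (use G(3) in \<open>auto simp: set_lebesgue_integral_def\<close>)
qed

section \<open>M. Riesz's theorem for a determinate law\<close>

locale determinate_orthogonal_polynomials = orthogonal_polynomials +
  assumes determinate: "\<And>\<nu> :: real measure. \<lbrakk>prob_space \<nu>; sets \<nu> = sets borel;
    \<And>n::nat. integrable \<nu> (\<lambda>x. x ^ n); \<And>n::nat. (\<integral>x. x ^ n \<partial>\<nu>) = (\<integral>x. x ^ n \<partial>\<mu>)\<rbrakk> \<Longrightarrow> \<nu> = \<mu>"
begin

text \<open>With Q(x) = (x - a)^2 + b^2, the claim is that polynomials approximate (x - a) / Q, the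
  real part of 1 / (x - z), in mean square with weight Q. A subsequence of the quadratures converges
  weakly to a law with the moments of \<open>\<mu>\<close>, which is \<open>\<mu>\<close> by
  determinacy; since 1 / Q is bounded and continuous, the excess term tends to zero along
  it.\<close>

lemma resolvent_approximation:
  assumes b: "0 < b" and e: "0 < e"
  obtains S where "(\<integral>x. ((x - a) / b + ((x - a)\<^sup>2 + b\<^sup>2) * poly S x)\<^sup>2 / ((x - a)\<^sup>2 + b\<^sup>2) \<partial>\<mu>) < e"
proof -
  define D where "D S = (\<integral>x. ((x - a) / b + ((x - a)\<^sup>2 + b\<^sup>2) * poly S x)\<^sup>2 / ((x - a)\<^sup>2 + b\<^sup>2) \<partial>\<mu>)" for S
  \<comment> \<open>The quadrature with parameter \<open>n + 2\<close> reproduces all moments of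
    order below \<open>2 * (n + 2)\<close>, in particular those up to \<open>n + 2\<close>.\<close>
  have "\<exists>\<sigma> S. real_distribution \<sigma> \<and>
      (\<forall>k \<le> n + 2. integrable \<sigma> (\<lambda>x. x ^ k) \<and> (\<integral>x. x ^ k \<partial>\<sigma>) = (\<integral>x. x ^ k \<partial>\<mu>)) \<and>
      (\<integral>x. 1 / ((x - a)\<^sup>2 + b\<^sup>2) \<partial>\<sigma>) = (\<integral>x. 1 / ((x - a)\<^sup>2 + b\<^sup>2) \<partial>\<mu>) + D S" for n
  proof (rule resolvent_quadrature[OF b, of "n + 2" a])
    fix \<sigma> S
    assume "real_distribution \<sigma>" "\<And>k. k < 2 * (n + 2) \<Longrightarrow> integrable \<sigma> (\<lambda>x. x ^ k)"
      "\<And>k. k < 2 * (n + 2) \<Longrightarrow> (\<integral>x. x ^ k \<partial>\<sigma>) = (\<integral>x. x ^ k \<partial>\<mu>)"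
      "(\<integral>x. 1 / ((x - a)\<^sup>2 + b\<^sup>2) \<partial>\<sigma>) = (\<integral>x. 1 / ((x - a)\<^sup>2 + b\<^sup>2) \<partial>\<mu>)
        + (\<integral>x. ((x - a) / b + ((x - a)\<^sup>2 + b\<^sup>2) * poly S x)\<^sup>2 / ((x - a)\<^sup>2 + b\<^sup>2) \<partial>\<mu>)"
    then show ?thesis unfolding D_def by (intro exI[of _ \<sigma>] exI[of _ S]) simp
  qed simp
  then obtain \<sigma> S where \<sigma>: "\<And>n. real_distribution (\<sigma> n)"
      "\<And>n k. k \<le> n + 2 \<Longrightarrow> integrable (\<sigma> n) (\<lambda>x. x ^ k)"
      "\<And>n k. k \<le> n + 2 \<Longrightarrow> (\<integral>x. x ^ k \<partial>\<sigma> n) = (\<integral>x. x ^ k \<partial>\<mu>)"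
      "\<And>n. (\<integral>x. 1 / ((x - a)\<^sup>2 + b\<^sup>2) \<partial>\<sigma> n) = (\<integral>x. 1 / ((x - a)\<^sup>2 + b\<^sup>2) \<partial>\<mu>) + D (S n)"
    by metis
  show thesis
  proof (rule subsequence_with_limit_moments[OF \<sigma>(1-3)])
    fix r \<nu>
    assume r: "real_distribution \<nu>" "weak_conv_m (\<sigma> \<circ> r) \<nu>"
      "\<And>k. integrable \<nu> (\<lambda>x. x ^ k)" "\<And>k. (\<integral>x. x ^ k \<partial>\<nu>) = (\<integral>x. x ^ k \<partial>\<mu>)"
    interpret \<nu>: real_distribution \<nu> by (rule r(1))
    have "\<nu> = \<mu>" using r by (intro determinate \<nu>.prob_space_axioms) auto
    have "(\<lambda>n. \<integral>x. 1 / ((x - a)\<^sup>2 + b\<^sup>2) \<partial>(\<sigma> \<circ> r) n) \<longlonglongrightarrow> (\<integral>x. 1 / ((x - a)\<^sup>2 + b\<^sup>2) \<partial>\<nu>)"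
    proof (rule weak_conv_imp_integral_bdd_continuous_conv[OF _ r(1,2), where B = "1 / b\<^sup>2"])
      have pos: "0 < (x - a)\<^sup>2 + b\<^sup>2" for x using b by (simp add: add_nonneg_pos)
      show "isCont (\<lambda>x. 1 / ((x - a)\<^sup>2 + b\<^sup>2)) x" for x
        using pos[of x] by (intro continuous_intros) auto
      show "norm (1 / ((x - a)\<^sup>2 + b\<^sup>2)) \<le> 1 / b\<^sup>2" for x
        using b pos[of x] by (auto intro!: divide_left_mono mult_pos_pos)
    qed (use \<sigma>(1) in simp)
    then have "(\<lambda>n. ((\<integral>x. 1 / ((x - a)\<^sup>2 + b\<^sup>2) \<partial>\<mu>) + D (S (r n))) - (\<integral>x. 1 / ((x - a)\<^sup>2 + b\<^sup>2) \<partial>\<mu>)) \<longlonglongrightarrow> 0"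
      unfolding \<open>\<nu> = \<mu>\<close> o_def \<sigma>(4) by (rule LIM_zero)
    then have "(\<lambda>n. D (S (r n))) \<longlonglongrightarrow> 0" by simp
    then have "\<forall>\<^sub>F n in sequentially. D (S (r n)) < e" using e by (rule order_tendstoD(2))
    then obtain n where "D (S (r n)) < e" by (auto dest: eventually_happens)
    then show thesis using that unfolding D_def by blast
  qed
qed

end

text \<open>\<open>Y\<close> may depend on more than \<open>U\<close>. In the application
  \<open>U\<close> is the present value of the process and \<open>Y\<close> the residual of the
  harness relation on an event of the past.\<close>

locale square_integrable_orthogonal = determinate_orthogonal_polynomials \<mu> p + \<Omega>: prob_space M
    for \<mu> p and M :: "'a measure" +
  fixes U Y :: "'a \<Rightarrow> real"
  assumes U [measurable]: "U \<in> borel_measurable M" and law_U: "distr M borel U = \<mu>"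
    and Y [measurable]: "Y \<in> borel_measurable M" and Y_square: "integrable M (\<lambda>\<omega>. (Y \<omega>)\<^sup>2)"
    and Y_orth: "\<And>m. (\<integral>\<omega>. Y \<omega> * U \<omega> ^ m \<partial>M) = 0"
begin

lemma Y_integrable: "integrable M Y"
  by (rule \<Omega>.square_integrable_imp_integrable[OF Y Y_square])

lemma integrable_law: "f \<in> borel_measurable borel \<Longrightarrow> integrable M (\<lambda>\<omega>. f (U \<omega>)) = integrable \<mu> f" for f :: "real \<Rightarrow> real"
  unfolding law_U[symmetric] by (rule integrable_distr_eq[symmetric]) auto

lemma integral_law: "f \<in> borel_measurable borel \<Longrightarrow> (\<integral>\<omega>. f (U \<omega>) \<partial>M) = (\<integral>x. f x \<partial>\<mu>)" for f :: "real \<Rightarrow> real"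
  unfolding law_U[symmetric] by (rule integral_distr[symmetric]) auto

lemma integrable_mult_square:
  fixes f :: "'a \<Rightarrow> real"
  assumes [measurable]: "f \<in> borel_measurable M" and "integrable M (\<lambda>\<omega>. (f \<omega>)\<^sup>2)"
  shows "integrable M (\<lambda>\<omega>. Y \<omega> * f \<omega>)"
proof (rule Bochner_Integration.integrable_bound)
  show "integrable M (\<lambda>\<omega>. (Y \<omega>)\<^sup>2 + (f \<omega>)\<^sup>2)" using Y_square assms(2) by simp
  show "AE \<omega> in M. norm (Y \<omega> * f \<omega>) \<le> norm ((Y \<omega>)\<^sup>2 + (f \<omega>)\<^sup>2)"
    unfolding real_norm_def by (intro AE_I2 order.trans[OF abs_mult_le_sum_squares] abs_ge_self)
qed measurable

lemma orth_poly: "integrable M (\<lambda>\<omega>. Y \<omega> * poly q (U \<omega>))" "(\<integral>\<omega>. Y \<omega> * poly q (U \<omega>) \<partial>M) = 0"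
proof -
  have int: "integrable M (\<lambda>\<omega>. Y \<omega> * U \<omega> ^ m)" for m
  proof (rule integrable_mult_square)
    show "integrable M (\<lambda>\<omega>. (U \<omega> ^ m)\<^sup>2)"
      using integrable_law[of "\<lambda>x. (x ^ m)\<^sup>2"] moments[of "m * 2"] by (simp add: power_mult)
  qed measurable
  have eq: "(\<lambda>\<omega>. Y \<omega> * poly q (U \<omega>)) = (\<lambda>\<omega>. \<Sum>i\<le>degree q. coeff q i * (Y \<omega> * U \<omega> ^ i))"
    by (auto simp: poly_altdef sum_distrib_left mult_ac)
  show "integrable M (\<lambda>\<omega>. Y \<omega> * poly q (U \<omega>))" unfolding eq using int by simp
  show "(\<integral>\<omega>. Y \<omega> * poly q (U \<omega>) \<partial>M) = 0" unfolding eq using int Y_orth by simp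
qed

text \<open>The kernel is the imaginary part of 1 / (U - z). Multiplying the approximation of the
  real part by x - a produces (x - a)^2 / Q = 1 - b^2 / Q, so b / Q differs from a polynomial by a
  function of small mean square.\<close>

lemma orth_poisson_kernel:
  assumes b: "0 < b"
  shows "(\<integral>\<omega>. Y \<omega> * (b / ((U \<omega> - a)\<^sup>2 + b\<^sup>2)) \<partial>M) = 0"
proof -
  define Q where "Q x = (x - a)\<^sup>2 + b\<^sup>2" for x
  have Q_pos: "0 < Q x" for x using b by (simp add: Q_def add_nonneg_pos)
  have Q_ge: "b\<^sup>2 \<le> Q x" for x by (simp add: Q_def)
  have Q_meas [measurable]: "Q \<in> borel_measurable borel" unfolding Q_def by measurable
  have kernel_int: "integrable M (\<lambda>\<omega>. Y \<omega> * (b / Q (U \<omega>)))"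
  proof (rule Bochner_Integration.integrable_bound)
    show "integrable M (\<lambda>\<omega>. Y \<omega> * (1 / b))" using Y_integrable by simp
    have "b / Q x \<le> 1 / b" for x
      using b Q_pos[of x] Q_ge[of x] by (simp add: field_simps power2_eq_square)
    then have "\<bar>Y \<omega>\<bar> * (b / Q (U \<omega>)) \<le> \<bar>Y \<omega>\<bar> * (1 / b)" for \<omega> by (rule mult_left_mono) simp
    moreover have "norm (Y \<omega> * (b / Q (U \<omega>))) = \<bar>Y \<omega>\<bar> * (b / Q (U \<omega>))" "norm (Y \<omega> * (1 / b)) = \<bar>Y \<omega>\<bar> * (1 / b)" for \<omega>
      using b Q_pos[of "U \<omega>"] by (simp_all add: abs_mult)
    ultimately show "AE \<omega> in M. norm (Y \<omega> * (b / Q (U \<omega>))) \<le> norm (Y \<omega> * (1 / b))"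
      by (intro AE_I2) (simp only:)
  qed measurable
  define J where "J = (\<integral>\<omega>. Y \<omega> * (b / Q (U \<omega>)) \<partial>M)"
  have bound: "\<bar>J\<bar> \<le> d * ((\<integral>\<omega>. (Y \<omega>)\<^sup>2 \<partial>M) + 1)" if d: "0 < d" for d
  proof -
    obtain S where S: "(\<integral>x. ((x - a) / b + Q x * poly S x)\<^sup>2 / Q x \<partial>\<mu>) < d\<^sup>2"
      using resolvent_approximation[OF b, of "d\<^sup>2" a] d unfolding Q_def by auto
    define P where "P x = (x - a) / b + Q x * poly S x" for x
    have P_meas [measurable]: "P \<in> borel_measurable borel" unfolding P_def by measurable
    \<comment> \<open>\<open>G\<close> is the approximation error for \<open>b / Q\<close>, up to
      sign. Its square is at most \<open>P^2 / Q\<close> because \<open>(x - a)^2\<close> is at most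
      \<open>Q\<close>.\<close>
    define G where "G x = (x - a) * P x / Q x" for x
    have G_meas [measurable]: "G \<in> borel_measurable borel" unfolding G_def by measurable
    have G_sq: "(G x)\<^sup>2 \<le> (P x)\<^sup>2 / Q x" for x
    proof -
      have "(x - a)\<^sup>2 / Q x \<le> 1" using Q_pos[of x] by (simp add: Q_def)
      then have "(x - a)\<^sup>2 / Q x * ((P x)\<^sup>2 / Q x) \<le> 1 * ((P x)\<^sup>2 / Q x)"
        using Q_pos[of x] by (intro mult_right_mono) auto
      then show ?thesis by (simp add: G_def power_mult_distrib power_divide power2_eq_square[of "Q x"])
    qed
    have P_poly: "P x = poly (smult (1 / b) [:-a, 1:] + [:a\<^sup>2 + b\<^sup>2, -2 * a, 1:] * S) x" for x
      by (simp add: P_def Q_def power2_eq_square diff_divide_distrib algebra_simps)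
    have PQ_int: "integrable \<mu> (\<lambda>x. (P x)\<^sup>2 / Q x)"
    proof (rule Bochner_Integration.integrable_bound)
      show "integrable \<mu> (\<lambda>x. (P x)\<^sup>2 / b\<^sup>2)"
        unfolding P_poly power2_eq_square[of "poly _ _"] by (intro integrable_divide integrable_poly_mult)
      show "AE x in \<mu>. norm ((P x)\<^sup>2 / Q x) \<le> norm ((P x)\<^sup>2 / b\<^sup>2)"
        using b Q_pos Q_ge by (auto intro!: divide_left_mono simp: less_imp_le abs_of_pos)
    qed measurable
    have G_int: "integrable \<mu> (\<lambda>x. (G x)\<^sup>2)"
      by (rule Bochner_Integration.integrable_bound[OF PQ_int]) (use G_sq Q_pos in \<open>auto simp: less_imp_le abs_of_pos\<close>)
    have GU_int: "integrable M (\<lambda>\<omega>. (G (U \<omega>))\<^sup>2)" using G_int by (subst integrable_law) auto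
    have G_small: "(\<integral>\<omega>. (G (U \<omega>))\<^sup>2 \<partial>M) \<le> d\<^sup>2"
    proof -
      have "(\<integral>\<omega>. (G (U \<omega>))\<^sup>2 \<partial>M) = (\<integral>x. (G x)\<^sup>2 \<partial>\<mu>)" by (subst integral_law) auto
      also have "\<dots> \<le> (\<integral>x. (P x)\<^sup>2 / Q x \<partial>\<mu>)" by (intro integral_mono G_int PQ_int G_sq)
      finally show ?thesis using S by (simp add: P_def)
    qed
    have YG_int: "integrable M (\<lambda>\<omega>. Y \<omega> * G (U \<omega>))" by (rule integrable_mult_square) (use GU_int in auto)
    have G_split: "y * G x = y * poly [:1 / b:] x - y * (b / Q x) + y * poly ([:-a, 1:] * S) x" for x y
    proof -
      have "(x - a)\<^sup>2 = Q x - b\<^sup>2" by (simp add: Q_def)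
      then have "(x - a)\<^sup>2 / Q x = 1 - b\<^sup>2 / Q x" using Q_pos[of x] by (simp add: diff_divide_distrib)
      moreover have "G x = (x - a)\<^sup>2 / Q x / b + (x - a) * poly S x"
        using Q_pos[of x] by (simp add: G_def P_def distrib_left add_divide_distrib power2_eq_square mult.commute[of b])
      ultimately have "G x = (1 - b\<^sup>2 / Q x) / b + (x - a) * poly S x" by simp
      then have "G x = 1 / b - b / Q x + (x - a) * poly S x"
        using b by (simp add: diff_divide_distrib power2_eq_square)
      then show ?thesis by (simp add: right_diff_distrib left_diff_distrib distrib_left)
    qed
    have "(\<integral>\<omega>. Y \<omega> * G (U \<omega>) \<partial>M) = - J"
      unfolding G_split J_def using orth_poly kernel_int by (simp del: mult_pCons_left poly_mult poly_pCons)
    then have "\<bar>J\<bar> = \<bar>\<integral>\<omega>. Y \<omega> * G (U \<omega>) \<partial>M\<bar>" by simp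
    also have "\<dots> \<le> (\<integral>\<omega>. \<bar>Y \<omega> * G (U \<omega>)\<bar> \<partial>M)" by (rule integral_abs_bound)
    \<comment> \<open>Weighted inequality between the arithmetic and geometric means; the weight
      \<open>d\<close> matches the bound \<open>d^2\<close> on the mean square of
      \<open>G\<close>.\<close>
    also have "\<dots> \<le> (\<integral>\<omega>. d * (Y \<omega>)\<^sup>2 + (G (U \<omega>))\<^sup>2 / d \<partial>M)"
    proof (rule integral_mono)
      fix \<omega>
      have "0 \<le> (d * \<bar>Y \<omega>\<bar> - \<bar>G (U \<omega>)\<bar>)\<^sup>2" by simp
      then have "2 * d * \<bar>Y \<omega> * G (U \<omega>)\<bar> \<le> d\<^sup>2 * (Y \<omega>)\<^sup>2 + (G (U \<omega>))\<^sup>2"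
        by (simp add: power2_diff power_mult_distrib abs_mult mult_ac)
      moreover have "0 \<le> d * \<bar>Y \<omega> * G (U \<omega>)\<bar>" using d by simp
      moreover have "d * (d * (Y \<omega>)\<^sup>2 + (G (U \<omega>))\<^sup>2 / d) = d\<^sup>2 * (Y \<omega>)\<^sup>2 + (G (U \<omega>))\<^sup>2"
        using d by (simp add: distrib_left power2_eq_square mult.assoc)
      ultimately have "d * \<bar>Y \<omega> * G (U \<omega>)\<bar> \<le> d * (d * (Y \<omega>)\<^sup>2 + (G (U \<omega>))\<^sup>2 / d)"
        by (simp only: mult.assoc)
      then show "\<bar>Y \<omega> * G (U \<omega>)\<bar> \<le> d * (Y \<omega>)\<^sup>2 + (G (U \<omega>))\<^sup>2 / d" using d by simp
    qed (use YG_int Y_square GU_int in auto)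
    also have "\<dots> = d * (\<integral>\<omega>. (Y \<omega>)\<^sup>2 \<partial>M) + (\<integral>\<omega>. (G (U \<omega>))\<^sup>2 \<partial>M) / d"
      using Y_square GU_int by simp
    also have "\<dots> \<le> d * (\<integral>\<omega>. (Y \<omega>)\<^sup>2 \<partial>M) + d"
      using G_small d by (simp add: divide_le_eq power2_eq_square)
    finally show ?thesis by (simp add: algebra_simps)
  qed
  have "((\<lambda>d. d * ((\<integral>\<omega>. (Y \<omega>)\<^sup>2 \<partial>M) + 1)) \<longlongrightarrow> 0 * ((\<integral>\<omega>. (Y \<omega>)\<^sup>2 \<partial>M) + 1)) (at_right 0)"
    by (intro tendsto_intros)
  moreover have "\<forall>\<^sub>F d in at_right 0. \<bar>J\<bar> \<le> d * ((\<integral>\<omega>. (Y \<omega>)\<^sup>2 \<partial>M) + 1)"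
    using eventually_at_right_less[of 0] by eventually_elim (rule bound)
  ultimately have "\<bar>J\<bar> \<le> 0 * ((\<integral>\<omega>. (Y \<omega>)\<^sup>2 \<partial>M) + 1)" by (rule tendsto_lowerbound) simp
  then show ?thesis by (simp add: J_def Q_def)
qed

text \<open>The arctangent is a primitive of the Poisson kernel in the variable \<open>a\<close>, so
  Fubini's theorem integrates the previous orthogonality over \<open>{c..d}\<close>.\<close>

lemma orth_arctan:
  assumes b: "0 < b" and cd: "c \<le> d"
  shows "(\<integral>\<omega>. Y \<omega> * (arctan ((d - U \<omega>) / b) - arctan ((c - U \<omega>) / b)) \<partial>M) = 0"
proof -
  interpret lborel: pair_sigma_finite M "lborel :: real measure" ..
  define k where "k u a = b / ((u - a)\<^sup>2 + b\<^sup>2)" for u a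
  have pos: "0 < (u - a)\<^sup>2 + b\<^sup>2" for u a using b by (simp add: add_nonneg_pos)
  have k_nonneg: "0 \<le> k u a" for u a using b by (simp add: k_def)
  have k_meas [measurable]: "(\<lambda>\<omega>. k (U (fst \<omega>)) (snd \<omega>)) \<in> borel_measurable (M \<Otimes>\<^sub>M lborel)"
    unfolding k_def by measurable
  have k_int: "has_bochner_integral lborel (\<lambda>a. k u a * indicator {c..d} a)
      (arctan ((d - u) / b) - arctan ((c - u) / b))" for u
  proof (rule has_bochner_integral_FTC_Icc_real[OF cd])
    fix a
    have "b\<^sup>2 * (1 + ((a - u) / b)\<^sup>2) = (u - a)\<^sup>2 + b\<^sup>2"
      using b by (simp add: power_divide distrib_left power2_commute[of u a])
    then have "k u a = b / (b * b * (1 + ((a - u) / b)\<^sup>2))" by (simp only: k_def power2_eq_square[of b])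
    then have k_eq: "inverse (1 + ((a - u) / b)\<^sup>2) / b = k u a"
      using b by (simp add: inverse_eq_divide mult_ac)
    then show "((\<lambda>a. arctan ((a - u) / b)) has_real_derivative k u a) (at a)"
      using b by (auto intro!: derivative_eq_intros simp: inverse_eq_divide)
    show "isCont (k u) a" unfolding k_def using pos[of u a] by (intro continuous_intros) auto
  qed
  define A where "A u = arctan ((d - u) / b) - arctan ((c - u) / b)" for u
  have A_meas [measurable]: "A \<in> borel_measurable borel" unfolding A_def by measurable
  have A_bound: "\<bar>A u\<bar> \<le> 2 * pi" for u
    unfolding A_def using arctan_bounded[of "(d - u) / b"] arctan_bounded[of "(c - u) / b"] by linarith
  define f where "f \<omega> a = Y \<omega> * (k (U \<omega>) a * indicator {c..d} a)" for \<omega> a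
  have f_meas: "case_prod f \<in> borel_measurable (M \<Otimes>\<^sub>M lborel)"
    unfolding f_def case_prod_beta by measurable
  have f_int: "has_bochner_integral lborel (f \<omega>) (Y \<omega> * A (U \<omega>))" for \<omega>
    unfolding f_def[abs_def] A_def by (intro has_bochner_integral_mult_right k_int)
  have norm_f_int: "(\<integral>a. norm (f \<omega> a) \<partial>lborel) = \<bar>Y \<omega>\<bar> * A (U \<omega>)" for \<omega>
  proof -
    have "has_bochner_integral lborel (\<lambda>a. \<bar>Y \<omega>\<bar> * (k (U \<omega>) a * indicator {c..d} a)) (\<bar>Y \<omega>\<bar> * A (U \<omega>))"
      unfolding A_def by (intro has_bochner_integral_mult_right k_int)
    from has_bochner_integral_integral_eq[OF this] show ?thesis
      using k_nonneg by (simp add: f_def abs_mult)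
  qed
  have "integrable M (\<lambda>\<omega>. \<bar>Y \<omega>\<bar> * A (U \<omega>))"
  proof (rule Bochner_Integration.integrable_bound)
    show "integrable M (\<lambda>\<omega>. 2 * pi * Y \<omega>)" using Y_integrable by simp
    show "AE \<omega> in M. norm (\<bar>Y \<omega>\<bar> * A (U \<omega>)) \<le> norm (2 * pi * Y \<omega>)"
    proof (rule AE_I2)
      fix \<omega>
      have "\<bar>A (U \<omega>)\<bar> * \<bar>Y \<omega>\<bar> \<le> 2 * pi * \<bar>Y \<omega>\<bar>" by (intro mult_right_mono A_bound) simp
      then show "norm (\<bar>Y \<omega>\<bar> * A (U \<omega>)) \<le> norm (2 * pi * Y \<omega>)" by (simp add: abs_mult mult.commute)
    qed
  qed measurable
  then have f_integrable: "integrable (M \<Otimes>\<^sub>M lborel) (case_prod f)"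
  proof (intro lborel.Fubini_integrable f_meas)
    show "AE \<omega> in M. integrable lborel (\<lambda>a. case_prod f (\<omega>, a))"
      using integrable.intros[OF f_int] by simp
  qed (simp add: norm_f_int[simplified])
  have "(\<integral>\<omega>. Y \<omega> * A (U \<omega>) \<partial>M) = (\<integral>\<omega>. (\<integral>a. f \<omega> a \<partial>lborel) \<partial>M)"
    by (simp only: has_bochner_integral_integral_eq[OF f_int])
  also have "\<dots> = (\<integral>a. (\<integral>\<omega>. f \<omega> a \<partial>M) \<partial>lborel)"
    by (rule lborel.Fubini_integral[OF f_integrable, symmetric])
  also have "\<dots> = (\<integral>a. indicator {c..d} a * (\<integral>\<omega>. Y \<omega> * k (U \<omega>) a \<partial>M) \<partial>lborel)"
    by (intro Bochner_Integration.integral_cong) (auto simp: f_def indicator_def)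
  also have "\<dots> = 0"
    unfolding k_def using orth_poisson_kernel[OF b] by simp
  finally show ?thesis by (simp add: A_def)
qed

text \<open>Stieltjes inversion: as the smoothing width tends to zero, the arctangent differences
  are bounded and tend to pi times the indicator, so dominated convergence applies.\<close>

lemma orth_interval: "(\<integral>\<omega>. Y \<omega> * indicator {c..d} (U \<omega>) \<partial>M) = 0"
proof (cases "c \<le> d")
  case True
  \<comment> \<open>The interval is enlarged by h = 1 / (n + 1) on both sides while the width is
    h^2. At an endpoint the argument is then h / h^2, which still tends to infinity, so the limit is
    the closed interval without half weights.\<close>
  define A where "A n x = arctan ((d + 1 / Suc n - x) / (1 / Suc n)\<^sup>2) - arctan ((c - 1 / Suc n - x) / (1 / Suc n)\<^sup>2)"
    for n :: nat and x
  have A_meas [measurable]: "A n \<in> borel_measurable borel" for n unfolding A_def by measurable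
  have A_bound: "\<bar>A n x\<bar> \<le> 2 * pi" for n x
    unfolding A_def using arctan_bounded[of "(d + 1 / Suc n - x) / (1 / Suc n)\<^sup>2"]
      arctan_bounded[of "(c - 1 / Suc n - x) / (1 / Suc n)\<^sup>2"] by linarith
  have A_lim: "(\<lambda>n. A n x) \<longlonglongrightarrow> pi * indicator {c..d} x" for x
  proof -
    have scale: "(y + 1 / Suc n) / (1 / Suc n)\<^sup>2 = y * (real (Suc n))\<^sup>2 + real (Suc n)" for y and n :: nat
      by (simp add: power2_eq_square field_simps)
    have step: "(\<lambda>n. arctan ((y + 1 / Suc n) / (1 / Suc n)\<^sup>2)) \<longlonglongrightarrow> (if 0 \<le> y then pi / 2 else - (pi / 2))" for y
    proof (cases "0 \<le> y")
      case True
      then have "filterlim (\<lambda>n. (y + 1 / Suc n) / (1 / Suc n)\<^sup>2) at_top sequentially"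
        unfolding scale
        by (intro filterlim_at_top_mono[OF filterlim_compose[OF filterlim_real_sequentially filterlim_Suc]] always_eventually) auto
      from filterlim_compose[OF tendsto_arctan_at_top this] show ?thesis using True by simp
    next
      case False
      then have y: "y < 0" by simp
      have "filterlim (\<lambda>n. - real (Suc n)) at_bot sequentially"
        by (intro filterlim_compose[OF filterlim_uminus_at_bot_at_top] filterlim_compose[OF filterlim_real_sequentially filterlim_Suc])
      moreover have "\<forall>\<^sub>F n in sequentially. y * (real (Suc n))\<^sup>2 + real (Suc n) \<le> - real (Suc n)"
      proof -
        obtain N where N: "- 2 / y \<le> real N" using real_arch_simple by blast
        have "y * (real (Suc n))\<^sup>2 + real (Suc n) \<le> - real (Suc n)" if "N \<le> n" for n
        proof -
          have "- 2 / y \<le> real (Suc n)" using N that by linarith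
          then have "y * real (Suc n) + 2 \<le> 0" using y by (simp add: field_simps)
          then have "(y * real (Suc n) + 2) * real (Suc n) \<le> 0" by (intro mult_nonpos_nonneg) auto
          then show ?thesis by (simp add: power2_eq_square algebra_simps)
        qed
        then show ?thesis by (auto intro: eventually_sequentiallyI)
      qed
      ultimately have "filterlim (\<lambda>n. (y + 1 / Suc n) / (1 / Suc n)\<^sup>2) at_bot sequentially"
        unfolding scale by (rule filterlim_at_bot_mono)
      from filterlim_compose[OF tendsto_arctan_at_bot this] show ?thesis using False by simp
    qed
    have A_eq: "A n x = arctan (((d - x) + 1 / Suc n) / (1 / Suc n)\<^sup>2) + arctan (((x - c) + 1 / Suc n) / (1 / Suc n)\<^sup>2)" for n
    proof -
      have "(c - 1 / Suc n - x) / (1 / Suc n)\<^sup>2 = - (((x - c) + 1 / Suc n) / (1 / Suc n)\<^sup>2)"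
        by (simp add: field_simps)
      then show ?thesis unfolding A_def by (simp add: arctan_minus algebra_simps)
    qed
    have "(\<lambda>n. A n x) \<longlonglongrightarrow> (if 0 \<le> d - x then pi / 2 else - (pi / 2)) + (if 0 \<le> x - c then pi / 2 else - (pi / 2))"
      unfolding A_eq by (intro tendsto_add step)
    also have "(if 0 \<le> d - x then pi / 2 else - (pi / 2)) + (if 0 \<le> x - c then pi / 2 else - (pi / 2)) = pi * indicator {c..d} x"
      using True by (auto simp: indicator_def)
    finally show ?thesis .
  qed
  have "(\<lambda>n. \<integral>\<omega>. Y \<omega> * A n (U \<omega>) \<partial>M) \<longlonglongrightarrow> (\<integral>\<omega>. Y \<omega> * (pi * indicator {c..d} (U \<omega>)) \<partial>M)"
  proof (rule integral_dominated_convergence)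
    show "integrable M (\<lambda>\<omega>. \<bar>Y \<omega>\<bar> * (2 * pi))" using Y_integrable by simp
    show "AE \<omega> in M. (\<lambda>n. Y \<omega> * A n (U \<omega>)) \<longlonglongrightarrow> Y \<omega> * (pi * indicator {c..d} (U \<omega>))"
      by (intro AE_I2 tendsto_mult tendsto_const A_lim)
    show "AE \<omega> in M. norm (Y \<omega> * A n (U \<omega>)) \<le> \<bar>Y \<omega>\<bar> * (2 * pi)" for n
      unfolding real_norm_def abs_mult by (intro AE_I2 mult_left_mono A_bound) simp
  qed measurable
  moreover have "(\<integral>\<omega>. Y \<omega> * A n (U \<omega>) \<partial>M) = 0" for n
    unfolding A_def
  proof (rule orth_arctan)
    have "c - 1 / real (Suc n) \<le> c" "d \<le> d + 1 / real (Suc n)" by simp_all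
    then show "c - 1 / real (Suc n) \<le> d + 1 / real (Suc n)" using True by linarith
  qed simp
  ultimately have "(\<integral>\<omega>. Y \<omega> * (pi * indicator {c..d} (U \<omega>)) \<partial>M) = 0"
    by (simp add: LIMSEQ_const_iff)
  moreover have "(\<lambda>\<omega>. Y \<omega> * (pi * indicator {c..d} (U \<omega>))) = (\<lambda>\<omega>. pi * (Y \<omega> * indicator {c..d} (U \<omega>)))"
    by (simp add: mult_ac)
  ultimately show ?thesis by simp
qed simp

text \<open>The closed intervals, among them the empty one, generate the Borel sets and are stable
  under intersection, so Dynkin's argument extends \<open>orth_interval\<close>.\<close>

theorem orth_indicator:
  assumes B: "B \<in> sets borel"
  shows "(\<integral>\<omega>. Y \<omega> * indicator B (U \<omega>) \<partial>M) = 0"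
proof -
  define G where "G = {U -` C \<inter> space M | C. C \<in> range (\<lambda>(c, d). {c..d::real})}"
  have ind: "indicator (U -` C \<inter> space M) \<omega> * Y \<omega> = Y \<omega> * indicator C (U \<omega>)" if "\<omega> \<in> space M" for C \<omega>
    using that by (auto simp: indicator_def)
  have ind_int: "(\<integral>\<omega>\<in>U -` C \<inter> space M. Y \<omega> \<partial>M) = (\<integral>\<omega>. Y \<omega> * indicator C (U \<omega>) \<partial>M)" for C
    unfolding set_lebesgue_integral_def by (intro Bochner_Integration.integral_cong) (simp_all add: ind)
  have "B \<in> sigma_sets UNIV (range (\<lambda>(c, d). {c..d}))"
    using B unfolding borel_eq_atLeastAtMost by simp
  then have "U -` B \<inter> space M \<in> {U -` C \<inter> space M | C. C \<in> sigma_sets UNIV (range (\<lambda>(c, d). {c..d}))}"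
    by (intro CollectI exI[of _ B] conjI refl)
  also have "\<dots> = sigma_sets (space M) G"
    unfolding G_def by (rule sigma_sets_vimage_commute) auto
  finally have "(\<integral>\<omega>\<in>U -` B \<inter> space M. Y \<omega> \<partial>M) = 0"
  proof (rule set_integral_zero_sigma_sets[rotated -1])
    show "integrable M Y" by (rule Y_integrable)
    show "(\<integral>\<omega>. Y \<omega> \<partial>M) = 0" using Y_orth[of 0] by simp
    show "G \<subseteq> sets M" unfolding G_def by (auto intro!: measurable_sets[OF U])
    show "(\<integral>\<omega>\<in>A. Y \<omega> \<partial>M) = 0" if "A \<in> G" for A
      using that orth_interval by (auto simp: G_def ind_int)
    show "Int_stable G"
    proof (rule Int_stableI)
      fix A1 A2 assume "A1 \<in> G" "A2 \<in> G"
      then obtain c1 d1 c2 d2 where "A1 = U -` {c1..d1} \<inter> space M" "A2 = U -` {c2..d2} \<inter> space M"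
        unfolding G_def by auto
      then have "A1 \<inter> A2 = U -` {max c1 c2..min d1 d2} \<inter> space M" by auto
      then show "A1 \<inter> A2 \<in> G" unfolding G_def by auto
    qed
  qed
  then show ?thesis by (simp add: ind_int)
qed

end

section \<open>Processes with orthogonal polynomial martingales\<close>

text \<open>Two independent values of the vector \<open>(v, w)\<close> determine all functions obeying the interpolation
  rule: the coefficients of the rule at any third point can be solved for.\<close>

lemma interpolation_imp_combination:
  fixes F :: "(real \<Rightarrow> real) set" and v w :: "real \<Rightarrow> real"
  assumes interp: "\<And>s t u. \<lbrakk>s \<in> I; t \<in> I; u \<in> I; s < t; t < u\<rbrakk> \<Longrightarrow> \<exists>b c. \<forall>f\<in>F. f t = b * f s + c * f u"
    and vw: "v \<in> F" "w \<in> F"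
    and s0: "s0 \<in> I" and u0: "u0 \<in> I" and less: "s0 < u0"
    and det: "v s0 * w u0 \<noteq> v u0 * w s0"
    and f: "f \<in> F"
  shows "\<exists>x y. \<forall>t\<in>I. f t = x * v t + y * w t"
proof -
  define D where "D = v s0 * w u0 - v u0 * w s0"
  have D: "D \<noteq> 0" using det by (simp add: D_def)
  \<comment> \<open>Cramer's rule for \<open>f = x * v + y * w\<close> at the two times
    \<open>s0\<close> and \<open>u0\<close>.\<close>
  define x y where "x = (f s0 * w u0 - f u0 * w s0) / D" and "y = (v s0 * f u0 - v u0 * f s0) / D"
  have fs: "f s0 = x * v s0 + y * w s0"
  proof -
    have "D * f s0 = (f s0 * w u0 - f u0 * w s0) * v s0 + (v s0 * f u0 - v u0 * f s0) * w s0"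
      by (simp add: D_def algebra_simps)
    then show ?thesis using D by (simp add: x_def y_def eq_divide_eq mult.commute flip: add_divide_distrib)
  qed
  have fu: "f u0 = x * v u0 + y * w u0"
  proof -
    have "D * f u0 = (f s0 * w u0 - f u0 * w s0) * v u0 + (v s0 * f u0 - v u0 * f s0) * w u0"
      by (simp add: D_def algebra_simps)
    then show ?thesis using D by (simp add: x_def y_def eq_divide_eq mult.commute flip: add_divide_distrib)
  qed
  have "f t = x * v t + y * w t" if t: "t \<in> I" for t
  proof -
    consider "t < s0" | "t = s0" | "s0 < t" "t < u0" | "t = u0" | "u0 < t" by linarith
    then show ?thesis
    proof cases
      case 1
      from interp[OF t s0 u0 1 less] obtain b c where bc: "\<And>g. g \<in> F \<Longrightarrow> g s0 = b * g t + c * g u0" by blast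
      \<comment> \<open>With \<open>b = 0\<close> the values of (v, w) at \<open>s0\<close> and
        \<open>u0\<close> would be proportional.\<close>
      have "b \<noteq> 0" using det bc[OF vw(1)] bc[OF vw(2)] by auto
      have "b * f t = x * (v s0 - c * v u0) + y * (w s0 - c * w u0)"
        using bc[OF f] fs fu by (simp add: algebra_simps)
      also have "\<dots> = b * (x * v t + y * w t)"
        using bc[OF vw(1)] bc[OF vw(2)] by (simp add: algebra_simps)
      finally show ?thesis using \<open>b \<noteq> 0\<close> by simp
    next
      case 3
      from interp[OF s0 t u0 3] obtain b c where bc: "\<And>g. g \<in> F \<Longrightarrow> g t = b * g s0 + c * g u0" by blast
      show ?thesis
        using bc[OF f] fs fu bc[OF vw(1)] bc[OF vw(2)] by (simp add: algebra_simps)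
    next
      case 5
      from interp[OF s0 u0 t less 5] obtain b c where bc: "\<And>g. g \<in> F \<Longrightarrow> g u0 = b * g s0 + c * g t" by blast
      have "c \<noteq> 0" using det bc[OF vw(1)] bc[OF vw(2)] by auto
      have "c * f t = x * (v u0 - b * v s0) + y * (w u0 - b * w s0)"
        using bc[OF f] fs fu by (simp add: algebra_simps)
      also have "\<dots> = c * (x * v t + y * w t)"
        using bc[OF vw(1)] bc[OF vw(2)] by (simp add: algebra_simps)
      finally show ?thesis using \<open>c \<noteq> 0\<close> by simp
    qed (use fs fu in auto)
  qed
  then show ?thesis by blast
qed

section \<open>Random variables with all moments\<close>

text \<open>On a probability space this class is an algebra that contains bounded variables, so the
  integrability of every product of polynomials and indicators below follows from closure
  rules.\<close>

definition all_moments :: "'a measure \<Rightarrow> ('a \<Rightarrow> real) \<Rightarrow> bool" where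
  "all_moments M Y \<longleftrightarrow> Y \<in> borel_measurable M \<and> (\<forall>n::nat. integrable M (\<lambda>\<omega>. Y \<omega> ^ n))"

lemma all_moments_integrable: "all_moments M Y \<Longrightarrow> integrable M Y"
  unfolding all_moments_def by (metis (no_types, lifting) Bochner_Integration.integrable_cong power_one_right)

context prob_space
begin

lemma all_moments_bounded:
  fixes B :: real
  assumes [measurable]: "Y \<in> borel_measurable M" and "\<And>\<omega>. \<bar>Y \<omega>\<bar> \<le> B"
  shows "all_moments M Y"
  unfolding all_moments_def
proof (intro conjI allI assms(1))
  show "integrable M (\<lambda>\<omega>. Y \<omega> ^ n)" for n
    by (rule integrable_const_bound[of _ "B ^ n"]) (use assms(2) in \<open>auto simp: power_abs intro!: power_mono\<close>)
qed

lemma integrable_power_mult: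
  assumes "all_moments M Y" "all_moments M Z"
  shows "integrable M (\<lambda>\<omega>. Y \<omega> ^ k * Z \<omega> ^ l)"
proof (rule Bochner_Integration.integrable_bound)
  have [measurable]: "Y \<in> borel_measurable M" "Z \<in> borel_measurable M"
    using assms by (auto simp: all_moments_def)
  show "(\<lambda>\<omega>. Y \<omega> ^ k * Z \<omega> ^ l) \<in> borel_measurable M" by measurable
  show "integrable M (\<lambda>\<omega>. Y \<omega> ^ (k * 2) + Z \<omega> ^ (l * 2))"
    using assms by (auto simp: all_moments_def)
  show "AE \<omega> in M. norm (Y \<omega> ^ k * Z \<omega> ^ l) \<le> norm (Y \<omega> ^ (k * 2) + Z \<omega> ^ (l * 2))"
    unfolding power_mult real_norm_def
    by (intro AE_I2 order.trans[OF abs_mult_le_sum_squares] abs_ge_self)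
qed

lemma all_moments_mult:
  assumes "all_moments M Y" "all_moments M Z"
  shows "all_moments M (\<lambda>\<omega>. Y \<omega> * Z \<omega>)"
  using integrable_power_mult[OF assms] assms by (auto simp: all_moments_def power_mult_distrib)

lemma all_moments_add:
  assumes "all_moments M Y" "all_moments M Z"
  shows "all_moments M (\<lambda>\<omega>. Y \<omega> + Z \<omega>)"
  unfolding all_moments_def binomial_ring
  using integrable_power_mult[OF assms] assms
  by (auto simp: all_moments_def mult.assoc intro!: Bochner_Integration.integrable_sum integrable_mult_right)

lemma all_moments_const: "all_moments M (\<lambda>_. c)"
  by (rule all_moments_bounded[of _ "\<bar>c\<bar>"]) auto

lemma all_moments_diff:
  assumes "all_moments M Y" "all_moments M Z"
  shows "all_moments M (\<lambda>\<omega>. Y \<omega> - Z \<omega>)"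
  using all_moments_add[OF assms(1) all_moments_mult[OF all_moments_const[of "-1"] assms(2)]] by simp

lemma all_moments_poly:
  assumes "all_moments M Y"
  shows "all_moments M (\<lambda>\<omega>. poly q (Y \<omega>))"
proof (induction q)
  case (pCons a q)
  show ?case using all_moments_add[OF all_moments_const[of a] all_moments_mult[OF assms pCons(2)]] by simp
qed (use all_moments_const[of 0] in simp)

lemma all_moments_indicator: "A \<in> sets M \<Longrightarrow> all_moments M (indicator A)"
  by (rule all_moments_bounded[of _ 1]) (auto simp: indicator_def)

end

section \<open>Sigma-algebras generated by the process\<close>

lemma space_gen_sigma [simp]: "space (gen_sigma M X S) = space M"
  by (auto simp: gen_sigma_def space_measure_of_conv)

lemma sets_gen_sigma:
  "sets (gen_sigma M X S) = sigma_sets (space M) {X v -` B \<inter> space M | v B. v \<in> S \<and> B \<in> sets borel}"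
  unfolding gen_sigma_def by (rule sets_measure_of) auto

lemma measurable_gen_sigma: "v \<in> S \<Longrightarrow> X v \<in> borel_measurable (gen_sigma M X S)"
  by (rule measurableI) (auto simp: sets_gen_sigma intro!: sigma_sets.Basic)

lemma gen_sigma_mono: "S \<subseteq> T \<Longrightarrow> sets (gen_sigma M X S) \<subseteq> sets (gen_sigma M X T)"
  unfolding sets_gen_sigma by (rule sigma_sets_mono') blast

lemma subalgebra_gen_sigma:
  assumes "\<And>v. v \<in> S \<Longrightarrow> X v \<in> borel_measurable M"
  shows "subalgebra M (gen_sigma M X S)"
  unfolding subalgebra_def sets_gen_sigma space_gen_sigma
  using assms by (intro conjI refl sets.sigma_sets_subset) (auto intro: measurable_sets)

lemma measurable_gen_sigma_mono:
  "Y \<in> measurable (gen_sigma M X S) N \<Longrightarrow> S \<subseteq> T \<Longrightarrow> Y \<in> measurable (gen_sigma M X T) N"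
  by (rule measurable_from_subalg[of _ "gen_sigma M X S"]) (simp_all add: subalgebra_def gen_sigma_mono)

lemma sets_gen_sigma_singleton:
  "sets (gen_sigma M X {w}) = {X w -` B \<inter> space M | B. B \<in> sets borel}"
proof -
  have "sets (gen_sigma M X {w}) = sigma_sets (space M) {X w -` B \<inter> space M | B. B \<in> sets borel}"
    unfolding sets_gen_sigma by (intro arg_cong2[of _ _ _ _ sigma_sets]) auto
  also have "\<dots> = {X w -` B \<inter> space M | B. B \<in> sigma_sets UNIV (sets borel)}"
    by (rule sigma_sets_vimage_commute[symmetric]) auto
  also have "sigma_sets UNIV (sets borel) = (sets borel :: real set set)"
    using sets.sigma_sets_eq[of "borel :: real measure"] by simp
  finally show ?thesis .
qed

text \<open>Truncated subtraction would turn the index -1 into 0, so the convention that p has no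
  term of index -1 is expressed by the case distinction on \<open>n = 0\<close>.\<close>

locale opm_recurrence =
  fixes M :: "'a measure" and X :: "real \<Rightarrow> 'a \<Rightarrow> real" and I :: "real set"
    and p :: "nat \<Rightarrow> real \<Rightarrow> real poly" and \<alpha> \<beta> \<gamma> :: "nat \<Rightarrow> real \<Rightarrow> real"
  assumes opm: "OPM M X I p"
    and alpha0: "\<And>t. t \<in> I \<Longrightarrow> \<alpha> 0 t = 0"
    and rec: "\<And>t n x. t \<in> I \<Longrightarrow> x * poly (p n t) x =
       \<alpha> (Suc n) t * poly (p (Suc n) t) x + \<beta> n t * poly (p n t) x
       + (if n = 0 then 0 else \<gamma> (n - 1) t * poly (p (n - 1) t) x)"
begin

lemma markov: "markov_process M X I" and standing: "standing_process M X I"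
  using opm by (auto simp: OPM_def MPR_def standing_process_def)

sublocale prob_space M using markov by (simp add: markov_process_def)

lemma X_measurable: "t \<in> I \<Longrightarrow> X t \<in> borel_measurable M"
  using markov by (simp add: markov_process_def)

lemma X_all_moments: "t \<in> I \<Longrightarrow> all_moments M (X t)"
  using standing X_measurable by (simp add: all_moments_def standing_process_def)

lemmas moments_intros = all_moments_add all_moments_diff all_moments_mult all_moments_const
  all_moments_poly X_all_moments

abbreviation past :: "real \<Rightarrow> 'a measure" where "past s \<equiv> past_sigma M X I s"

lemma past_subalgebra: "subalgebra M (past s)"
  unfolding past_sigma_def by (rule subalgebra_gen_sigma) (simp add: X_measurable)

lemma gen_subalgebra: "S \<subseteq> I \<Longrightarrow> subalgebra M (gen_sigma M X S)"
  by (rule subalgebra_gen_sigma) (auto simp: X_measurable)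

lemma sigma_finite_subalgebraI: "subalgebra M F \<Longrightarrow> sigma_finite_subalgebra M F"
  by (rule finite_measure_subalgebra_is_sigma_finite)
    (simp add: finite_measure_subalgebra_def finite_measure_subalgebra_axioms_def finite_measure_axioms)

lemma past_measurable_mono: "Y \<in> borel_measurable (past s) \<Longrightarrow> s \<le> t \<Longrightarrow> Y \<in> borel_measurable (past t)"
  unfolding past_sigma_def by (erule measurable_gen_sigma_mono) auto

lemma X_past: "s \<in> I \<Longrightarrow> s \<le> t \<Longrightarrow> X s \<in> borel_measurable (past t)"
  unfolding past_sigma_def by (rule measurable_gen_sigma) simp

lemma space_past [simp]: "space (past s) = space M"
  by (simp add: past_sigma_def)

lemma degree_p: "t \<in> I \<Longrightarrow> degree (p n t) = n" and p_0: "t \<in> I \<Longrightarrow> p 0 t = 1"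
  using opm by (auto simp: OPM_def)

section \<open>Martingale identities and the Jacobi matrix\<close>

lemma martingale:
  assumes "s \<in> I" "t \<in> I" "s \<le> t" "Y \<in> borel_measurable (past s)" "all_moments M Y"
  shows "(\<integral>\<omega>. Y \<omega> * poly (p n t) (X t \<omega>) \<partial>M) = (\<integral>\<omega>. Y \<omega> * poly (p n s) (X s \<omega>) \<partial>M)"
proof -
  interpret sigma_finite_subalgebra M "past s"
    by (rule sigma_finite_subalgebraI[OF past_subalgebra])
  have ae: "AE \<omega> in M. real_cond_exp M (past s) (\<lambda>\<omega>. poly (p n t) (X t \<omega>)) \<omega> = poly (p n s) (X s \<omega>)"
    using opm assms(1-3) by (auto simp: OPM_def)
  have [measurable]: "Y \<in> borel_measurable M" "X s \<in> borel_measurable M" "X t \<in> borel_measurable M"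
    using assms X_measurable by (auto simp: all_moments_def)
  have "(\<integral>\<omega>. Y \<omega> * poly (p n t) (X t \<omega>) \<partial>M) =
      (\<integral>\<omega>. Y \<omega> * real_cond_exp M (past s) (\<lambda>\<omega>. poly (p n t) (X t \<omega>)) \<omega> \<partial>M)"
    using assms by (intro real_cond_exp_intg(2)[symmetric] all_moments_integrable moments_intros) auto
  also have "\<dots> = (\<integral>\<omega>. Y \<omega> * poly (p n s) (X s \<omega>) \<partial>M)"
    by (rule integral_cong_AE) (use ae in \<open>measurable, auto elim: eventually_mono\<close>)
  finally show ?thesis .
qed

text \<open>The recurrence expands \<open>X t\<close> times \<open>p n t\<close> into polynomials at
  time \<open>t\<close>, and the martingale property moves each of them back to time
  \<open>s\<close>. So coefficients at \<open>t\<close> meet expectations \<open>e k\<close> at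
  \<open>s\<close> that do not depend on \<open>t\<close>.\<close>

lemma recurrence_expectation:
  assumes "s \<in> I" "t \<in> I" "s \<le> t" "Y \<in> borel_measurable (past s)" "all_moments M Y"
  defines "e k \<equiv> (\<integral>\<omega>. Y \<omega> * poly (p k s) (X s \<omega>) \<partial>M)"
  shows "(\<integral>\<omega>. Y \<omega> * X t \<omega> * poly (p n t) (X t \<omega>) \<partial>M) =
    \<alpha> (Suc n) t * e (Suc n) + \<beta> n t * e n + (if n = 0 then 0 else \<gamma> (n - 1) t * e (n - 1))"
proof -
  have e: "e k = (\<integral>\<omega>. Y \<omega> * poly (p k t) (X t \<omega>) \<partial>M)" for k
    unfolding e_def using assms(1-5) by (rule martingale[symmetric])
  have int: "integrable M (\<lambda>\<omega>. Y \<omega> * poly (p k t) (X t \<omega>))" for k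
    using assms by (intro all_moments_integrable moments_intros)
  have eq: "Y \<omega> * X t \<omega> * poly (p n t) (X t \<omega>) = \<alpha> (Suc n) t * (Y \<omega> * poly (p (Suc n) t) (X t \<omega>))
      + \<beta> n t * (Y \<omega> * poly (p n t) (X t \<omega>))
      + (if n = 0 then 0 else \<gamma> (n - 1) t) * (Y \<omega> * poly (p (n - 1) t) (X t \<omega>))" for \<omega>
    using rec[OF assms(2), of "X t \<omega>" n] by (simp add: mult.assoc algebra_simps)
  show ?thesis unfolding eq e using int by simp
qed

definition sqnorm :: "nat \<Rightarrow> real \<Rightarrow> real" where
  "sqnorm n t = (\<integral>\<omega>. poly (p n t) (X t \<omega>) * poly (p n t) (X t \<omega>) \<partial>M)"

lemma p_orthogonal:
  assumes "t \<in> I"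
  shows "(\<integral>\<omega>. poly (p n t) (X t \<omega>) * poly (p m t) (X t \<omega>) \<partial>M) = (if n = m then sqnorm n t else 0)"
proof -
  obtain phat where "\<forall>t\<in>I. \<forall>n m. (\<integral>\<omega>. poly (p n t) (X t \<omega>) * poly (p m t) (X t \<omega>) \<partial>M) = (if n = m then phat n t else 0)"
    using opm by (auto simp: OPM_def)
  then show ?thesis using assms by (simp add: sqnorm_def)
qed

lemma X_integral_law: "t \<in> I \<Longrightarrow> (f :: real \<Rightarrow> real) \<in> borel_measurable borel \<Longrightarrow> (\<integral>x. f x \<partial>law M X t) = (\<integral>\<omega>. f (X t \<omega>) \<partial>M)"
  unfolding law_def by (rule integral_distr[OF X_measurable])

lemma determinate_law:
  assumes t: "t \<in> I"
  shows "determinate_orthogonal_polynomials (law M X t) (\<lambda>n. p n t)"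
proof -
  interpret L: prob_space "law M X t" unfolding law_def by (rule prob_space_distr[OF X_measurable[OF t]])
  interpret L: moment_distribution "law M X t"
  proof
    show "sets (law M X t) = sets borel" by (simp add: law_def)
    show "integrable (law M X t) (\<lambda>x. x ^ n)" for n :: nat
      unfolding law_def using X_all_moments[OF t]
      by (subst integrable_distr_eq) (auto simp: X_measurable[OF t] all_moments_def)
    show "infinite (measure_support (law M X t))" using standing t by (simp add: standing_process_def)
  qed
  have p_nz: "p n t \<noteq> 0" for n
    using degree_p[OF t, of n] p_0[OF t] by (cases "n = 0") auto
  show ?thesis
  proof
    show "degree (p n t) = n" for n by (rule degree_p[OF t])
    show "p n t \<noteq> 0" for n by (rule p_nz)
    show "(\<integral>x. poly (p i t) x * poly (p j t) x \<partial>law M X t) = 0" if "i \<noteq> j" for i j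
      using that p_orthogonal[OF t] by (subst X_integral_law[OF t]) auto
    fix \<nu> :: "real measure"
    assume \<nu>: "prob_space \<nu>" "sets \<nu> = sets borel" "\<And>n::nat. integrable \<nu> (\<lambda>x. x ^ n)"
      "\<And>n::nat. (\<integral>x. x ^ n \<partial>\<nu>) = (\<integral>x. x ^ n \<partial>law M X t)"
    have "(\<integral>x. x ^ n \<partial>\<nu>) = (\<integral>\<omega>. X t \<omega> ^ n \<partial>M)" for n
      unfolding \<nu>(4) by (rule X_integral_law[OF t]) measurable
    then show "\<nu> = law M X t" using standing t \<nu>(1-3) unfolding standing_process_def by blast
  qed
qed

lemma sqnorm_pos:
  assumes t: "t \<in> I"
  shows "0 < sqnorm n t"
proof -
  interpret L: determinate_orthogonal_polynomials "law M X t" "\<lambda>n. p n t" by (rule determinate_law[OF t])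
  have eq: "sqnorm n t = (\<integral>x. poly (p n t * p n t) x \<partial>law M X t)"
    unfolding sqnorm_def by (subst X_integral_law[OF t]) auto
  have "sqnorm n t \<noteq> 0"
    using L.integral_poly_nonneg_zeroD[of "p n t * p n t"] L.p_nonzero[of n] eq by auto
  moreover have "0 \<le> sqnorm n t" unfolding eq by simp
  ultimately show ?thesis by simp
qed

text \<open>The coefficient of \<open>p m t\<close> in the expansion of x times
  \<open>p n t\<close>, so column \<open>n\<close> is the recurrence for index
  \<open>n\<close>.\<close>

definition jacobi :: "nat \<Rightarrow> nat \<Rightarrow> real \<Rightarrow> real" where
  "jacobi m n t = (if m = Suc n then \<alpha> m t else if m = n then \<beta> n t else if Suc m = n then \<gamma> m t else 0)"

lemma jacobi_expectation:
  assumes "s \<in> I" "t \<in> I" "s \<le> t"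
  shows "(\<integral>\<omega>. poly (p m s) (X s \<omega>) * X t \<omega> * poly (p n t) (X t \<omega>) \<partial>M) = jacobi m n t * sqnorm m s"
proof -
  have [measurable]: "X s \<in> borel_measurable (past s)" using X_past[OF assms(1)] by simp
  have "(\<lambda>\<omega>. poly (p m s) (X s \<omega>)) \<in> borel_measurable (past s)" by measurable
  moreover have "all_moments M (\<lambda>\<omega>. poly (p m s) (X s \<omega>))" using assms by (intro moments_intros)
  ultimately show ?thesis
    using recurrence_expectation[OF assms, of "\<lambda>\<omega>. poly (p m s) (X s \<omega>)" n]
    unfolding p_orthogonal[OF assms(1)] by (auto simp: jacobi_def)
qed

text \<open>The martingale property replaces \<open>p n u\<close> by the polynomial at the time of
  the other factor, after which every term is a Jacobi entry times the same positive number
  \<open>sqnorm m s\<close>, which cancels. The time inequalities are weak so that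
  \<open>u = t\<close> covers the degenerate case.\<close>

lemma three_point_relation:
  assumes "s \<in> I" "t \<in> I" "u \<in> I" "s \<le> t" "t \<le> u"
    and proj: "\<And>m n. (\<integral>\<omega>. X t \<omega> * (poly (p m s) (X s \<omega>) * poly (p n u) (X u \<omega>)) \<partial>M) =
       (\<integral>\<omega>. (a + b * X s \<omega> + c * X u \<omega>) * (poly (p m s) (X s \<omega>) * poly (p n u) (X u \<omega>)) \<partial>M)"
  shows "jacobi m n t = (if m = n then a else 0) + b * jacobi m n s + c * jacobi m n u"
proof -
  have su: "s \<le> u" using assms by simp
  have [measurable]: "X s \<in> borel_measurable (past s)" "X s \<in> borel_measurable (past t)" "X t \<in> borel_measurable (past t)"
    using X_past assms by auto
  have ps: "(\<lambda>\<omega>. poly (p m s) (X s \<omega>)) \<in> borel_measurable (past s)" for m by measurable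
  have psX: "(\<lambda>\<omega>. poly (p m s) (X s \<omega>) * X s \<omega>) \<in> borel_measurable (past s)" for m by measurable
  have ptX: "(\<lambda>\<omega>. poly (p m s) (X s \<omega>) * X t \<omega>) \<in> borel_measurable (past t)" for m by measurable
  have am: "all_moments M (\<lambda>\<omega>. poly (p m s) (X s \<omega>))" "all_moments M (\<lambda>\<omega>. poly (p m s) (X s \<omega>) * X s \<omega>)"
    "all_moments M (\<lambda>\<omega>. poly (p m s) (X s \<omega>) * X t \<omega>)"
    using assms by (intro moments_intros; simp)+
  have e1: "(\<integral>\<omega>. poly (p m s) (X s \<omega>) * poly (p n u) (X u \<omega>) \<partial>M) = (if m = n then sqnorm m s else 0)"
    using martingale[OF assms(1,3) su ps am(1)] p_orthogonal[OF assms(1)] by simp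
  have e2: "(\<integral>\<omega>. poly (p m s) (X s \<omega>) * X s \<omega> * poly (p n u) (X u \<omega>) \<partial>M) = jacobi m n s * sqnorm m s"
    using martingale[OF assms(1,3) su psX am(2)] jacobi_expectation[OF assms(1,1)] by simp
  have e3: "(\<integral>\<omega>. poly (p m s) (X s \<omega>) * X t \<omega> * poly (p n u) (X u \<omega>) \<partial>M) = jacobi m n t * sqnorm m s"
    using martingale[OF assms(2,3,5) ptX am(3)] jacobi_expectation[OF assms(1,2,4)] by simp
  have e4: "(\<integral>\<omega>. poly (p m s) (X s \<omega>) * X u \<omega> * poly (p n u) (X u \<omega>) \<partial>M) = jacobi m n u * sqnorm m s"
    by (rule jacobi_expectation[OF assms(1,3) su])
  have "jacobi m n t * sqnorm m s = (\<integral>\<omega>. X t \<omega> * (poly (p m s) (X s \<omega>) * poly (p n u) (X u \<omega>)) \<partial>M)"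
    unfolding e3[symmetric] by (simp add: mult_ac)
  also have "\<dots> = (\<integral>\<omega>. a * (poly (p m s) (X s \<omega>) * poly (p n u) (X u \<omega>))
      + b * (poly (p m s) (X s \<omega>) * X s \<omega> * poly (p n u) (X u \<omega>))
      + c * (poly (p m s) (X s \<omega>) * X u \<omega> * poly (p n u) (X u \<omega>)) \<partial>M)"
    unfolding proj by (simp add: algebra_simps)
  also have "\<dots> = a * (if m = n then sqnorm m s else 0) + b * (jacobi m n s * sqnorm m s) + c * (jacobi m n u * sqnorm m s)"
  proof -
    have "integrable M (\<lambda>\<omega>. poly (p m s) (X s \<omega>) * poly (p n u) (X u \<omega>))"
      "integrable M (\<lambda>\<omega>. poly (p m s) (X s \<omega>) * X s \<omega> * poly (p n u) (X u \<omega>))"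
      "integrable M (\<lambda>\<omega>. poly (p m s) (X s \<omega>) * X u \<omega> * poly (p n u) (X u \<omega>))"
      using assms by (intro all_moments_integrable moments_intros; simp)+
    then show ?thesis unfolding e1[symmetric] e2[symmetric] e4[symmetric] by simp
  qed
  also have "\<dots> = ((if m = n then a else 0) + b * jacobi m n s + c * jacobi m n u) * sqnorm m s"
    by (simp add: algebra_simps)
  finally show ?thesis using sqnorm_pos[OF assms(1), of m] by simp
qed

text \<open>Taking \<open>\<beta>\<close> relative to index 0 eliminates the constant
  \<open>a\<close> on the diagonal, so that all members obey one homogeneous rule with the same
  \<open>b\<close> and \<open>c\<close>.\<close>

definition recurrence_functions :: "(real \<Rightarrow> real) set" where
  "recurrence_functions = range \<alpha> \<union> range \<gamma> \<union> range (\<lambda>n t. \<beta> n t - \<beta> 0 t)"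

lemma recurrence_functions_relation:
  assumes "s \<in> I" "t \<in> I" "u \<in> I"
    and rel: "\<And>m n. jacobi m n t = (if m = n then a else 0) + b * jacobi m n s + c * jacobi m n u"
    and f: "f \<in> recurrence_functions"
  shows "f t = b * f s + c * f u"
proof -
  have "\<alpha> n t = b * \<alpha> n s + c * \<alpha> n u" for n
    using rel[of n "n - 1"] assms(1-3) by (cases n) (auto simp: jacobi_def alpha0)
  moreover have "\<gamma> n t = b * \<gamma> n s + c * \<gamma> n u" for n
    using rel[of n "Suc n"] by (simp add: jacobi_def)
  moreover have "\<beta> n t - \<beta> 0 t = b * (\<beta> n s - \<beta> 0 s) + c * (\<beta> n u - \<beta> 0 u)" for n
    using rel[of n n] rel[of 0 0] by (simp add: jacobi_def algebra_simps)
  ultimately show ?thesis using f by (auto simp: recurrence_functions_def)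
qed

section \<open>Signs of the coefficients, and the martingale of degree one\<close>

lemma X_eq: "t \<in> I \<Longrightarrow> X t \<omega> = \<alpha> 1 t * poly (p 1 t) (X t \<omega>) + \<beta> 0 t"
  using rec[of t "X t \<omega>" 0] p_0 by simp

text \<open>Comparison of degrees: x times \<open>p n t\<close> has degree \<open>n + 1\<close>, and
  only the first term of the recurrence can reach it.\<close>

lemma alpha_nonzero:
  assumes t: "t \<in> I"
  shows "\<alpha> (Suc n) t \<noteq> 0"
proof
  assume 0: "\<alpha> (Suc n) t = 0"
  define q where "q = smult (\<beta> n t) (p n t) + (if n = 0 then 0 else smult (\<gamma> (n - 1) t) (p (n - 1) t))"
  have "poly ([:0, 1:] * p n t) x = poly q x" for x
    using rec[OF t, of x n] 0 by (simp add: q_def)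
  then have "[:0, 1:] * p n t = q" by (intro poly_eq_poly_eq_iff[THEN iffD1] ext)
  moreover have "degree ([:0, 1:] * p n t) = Suc n"
    using degree_p[OF t, of n] p_0[OF t] by (cases "p n t = 0") (auto simp: degree_mult_eq)
  moreover have "degree q \<le> n"
    unfolding q_def using degree_p[OF t]
    by (auto intro!: degree_add_le order.trans[OF degree_smult_le])
  ultimately show False by simp
qed

text \<open>Multiplication by \<open>X t\<close> is symmetric, so two mirrored Jacobi entries
  compute the same expectation.\<close>

lemma gamma_eq:
  assumes t: "t \<in> I"
  shows "\<gamma> n t * sqnorm n t = \<alpha> (Suc n) t * sqnorm (Suc n) t"
proof -
  have "(\<integral>\<omega>. poly (p n t) (X t \<omega>) * X t \<omega> * poly (p (Suc n) t) (X t \<omega>) \<partial>M) =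
      (\<integral>\<omega>. poly (p (Suc n) t) (X t \<omega>) * X t \<omega> * poly (p n t) (X t \<omega>) \<partial>M)"
    by (simp add: mult_ac)
  then show ?thesis unfolding jacobi_expectation[OF t t order.refl] by (simp add: jacobi_def)
qed

lemma alpha_gamma_pos:
  assumes t: "t \<in> I"
  shows "0 < \<alpha> (Suc n) t * \<gamma> n t"
proof -
  have "\<alpha> (Suc n) t * \<gamma> n t * sqnorm n t = (\<alpha> (Suc n) t)\<^sup>2 * sqnorm (Suc n) t"
    using gamma_eq[OF t, of n] by (simp add: power2_eq_square)
  also have "\<dots> > 0" using alpha_nonzero[OF t, of n] sqnorm_pos[OF t, of "Suc n"] by simp
  finally show ?thesis using sqnorm_pos[OF t, of n] by (simp add: zero_less_mult_iff)
qed

lemma gamma_0: "t \<in> I \<Longrightarrow> \<gamma> 0 t = \<alpha> 1 t * sqnorm 1 t"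
  using gamma_eq[of t 0] p_0 by (simp add: sqnorm_def prob_space)

text \<open>Orthogonality of martingale increments: the mixed term is the second moment at the
  earlier time. It also shows that \<open>sqnorm 1\<close> is monotone.\<close>

lemma increment_sqnorm:
  assumes "s \<in> I" "t \<in> I" "s \<le> t"
  shows "(\<integral>\<omega>. (poly (p 1 t) (X t \<omega>) - poly (p 1 s) (X s \<omega>))\<^sup>2 \<partial>M) = sqnorm 1 t - sqnorm 1 s"
proof -
  have [measurable]: "X s \<in> borel_measurable (past s)" using X_past assms by auto
  have "(\<lambda>\<omega>. poly (p 1 s) (X s \<omega>)) \<in> borel_measurable (past s)" by measurable
  then have cross: "(\<integral>\<omega>. poly (p 1 s) (X s \<omega>) * poly (p 1 t) (X t \<omega>) \<partial>M) = sqnorm 1 s"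
    unfolding sqnorm_def using assms by (intro martingale moments_intros)
  have "integrable M (\<lambda>\<omega>. poly (p 1 t) (X t \<omega>) * poly (p 1 t) (X t \<omega>))"
    "integrable M (\<lambda>\<omega>. poly (p 1 s) (X s \<omega>) * poly (p 1 s) (X s \<omega>))"
    "integrable M (\<lambda>\<omega>. poly (p 1 s) (X s \<omega>) * poly (p 1 t) (X t \<omega>))"
    using assms by (intro all_moments_integrable moments_intros; simp)+
  then have "(\<integral>\<omega>. poly (p 1 t) (X t \<omega>) * poly (p 1 t) (X t \<omega>) + poly (p 1 s) (X s \<omega>) * poly (p 1 s) (X s \<omega>)
      - 2 * (poly (p 1 s) (X s \<omega>) * poly (p 1 t) (X t \<omega>)) \<partial>M) =
      sqnorm 1 t + sqnorm 1 s - 2 * (\<integral>\<omega>. poly (p 1 s) (X s \<omega>) * poly (p 1 t) (X t \<omega>) \<partial>M)"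
    by (simp add: sqnorm_def)
  then have "(\<integral>\<omega>. poly (p 1 t) (X t \<omega>) * poly (p 1 t) (X t \<omega>) + poly (p 1 s) (X s \<omega>) * poly (p 1 s) (X s \<omega>)
      - 2 * (poly (p 1 s) (X s \<omega>) * poly (p 1 t) (X t \<omega>)) \<partial>M) = sqnorm 1 t + sqnorm 1 s - 2 * sqnorm 1 s"
    unfolding cross .
  then show ?thesis by (simp add: power2_eq_square algebra_simps)
qed

lemma sqnorm_1_mono:
  assumes "s \<in> I" "t \<in> I" "s \<le> t"
  shows "sqnorm 1 s \<le> sqnorm 1 t"
proof -
  have "0 \<le> (\<integral>\<omega>. (poly (p 1 t) (X t \<omega>) - poly (p 1 s) (X s \<omega>))\<^sup>2 \<partial>M)" by simp
  then show ?thesis unfolding increment_sqnorm[OF assms] by simp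
qed

lemma degenerate_affine:
  assumes "s \<in> I" "t \<in> I" "s \<le> t" "sqnorm 1 s = sqnorm 1 t"
  defines "B \<equiv> \<alpha> 1 t / \<alpha> 1 s"
  shows "AE \<omega> in M. X t \<omega> = (\<beta> 0 t - B * \<beta> 0 s) + B * X s \<omega>"
proof -
  have "integrable M (\<lambda>\<omega>. (poly (p 1 t) (X t \<omega>) - poly (p 1 s) (X s \<omega>))\<^sup>2)"
    unfolding power2_eq_square using assms(1,2) by (intro all_moments_integrable moments_intros)
  then have "AE \<omega> in M. (poly (p 1 t) (X t \<omega>) - poly (p 1 s) (X s \<omega>))\<^sup>2 = 0"
    using increment_sqnorm[OF assms(1-3)] assms(4)
    by (subst integral_nonneg_eq_0_iff_AE[symmetric]) auto
  then show ?thesis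
  proof eventually_elim
    case (elim \<omega>)
    then have "poly (p 1 t) (X t \<omega>) = poly (p 1 s) (X s \<omega>)" by simp
    then have "X t \<omega> = \<alpha> 1 t * poly (p 1 s) (X s \<omega>) + \<beta> 0 t" using X_eq[OF assms(2), of \<omega>] by simp
    moreover have "B * X s \<omega> = B * (\<alpha> 1 s * poly (p 1 s) (X s \<omega>) + \<beta> 0 s)"
      using X_eq[OF assms(1), of \<omega>] by (rule arg_cong)
    moreover have "B * \<alpha> 1 s = \<alpha> 1 t"
      using alpha_nonzero[OF assms(1), of 0] by (simp add: B_def)
    then have "B * (\<alpha> 1 s * poly (p 1 s) (X s \<omega>) + \<beta> 0 s) = \<alpha> 1 t * poly (p 1 s) (X s \<omega>) + B * \<beta> 0 s"
      by (simp only: distrib_left flip: mult.assoc)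
    ultimately show ?case by linarith
  qed
qed

lemma degenerate_relation:
  assumes "s \<in> I" "t \<in> I" "s \<le> t" "sqnorm 1 s = sqnorm 1 t"
  shows "\<exists>b. \<forall>f\<in>recurrence_functions. f t = b * f s"
proof -
  define B where "B = \<alpha> 1 t / \<alpha> 1 s"
  \<comment> \<open>The affine dependence on \<open>X s\<close> is read as a three-point relation
    whose third time is \<open>t\<close> itself, with weight zero.\<close>
  have "jacobi m n t = (if m = n then \<beta> 0 t - B * \<beta> 0 s else 0) + B * jacobi m n s + 0 * jacobi m n t" for m n
  proof (rule three_point_relation[OF assms(1,2,2,3) order.refl])
    fix m n
    have [measurable]: "X s \<in> borel_measurable M" "X t \<in> borel_measurable M" using assms X_measurable by auto
    show "(\<integral>\<omega>. X t \<omega> * (poly (p m s) (X s \<omega>) * poly (p n t) (X t \<omega>)) \<partial>M) =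
       (\<integral>\<omega>. (\<beta> 0 t - B * \<beta> 0 s + B * X s \<omega> + 0 * X t \<omega>) * (poly (p m s) (X s \<omega>) * poly (p n t) (X t \<omega>)) \<partial>M)"
    proof (rule integral_cong_AE)
      show "AE \<omega> in M. X t \<omega> * (poly (p m s) (X s \<omega>) * poly (p n t) (X t \<omega>)) =
       (\<beta> 0 t - B * \<beta> 0 s + B * X s \<omega> + 0 * X t \<omega>) * (poly (p m s) (X s \<omega>) * poly (p n t) (X t \<omega>))"
        using degenerate_affine[OF assms, folded B_def] by eventually_elim simp
    qed measurable
  qed
  from recurrence_functions_relation[OF assms(1,2,2) this] show ?thesis by (intro exI[of _ B]) simp
qed

section \<open>From a harness to the linear form of the coefficients\<close>

lemma harness_relation:
  assumes h: "harness M X I" and "s \<in> I" "t \<in> I" "u \<in> I" "s < t" "t < u"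
  shows "\<exists>b c. \<forall>f\<in>recurrence_functions. f t = b * f s + c * f u"
proof -
  let ?F = "outer_sigma M X I s u"
  obtain a b c where ae: "AE \<omega> in M. real_cond_exp M ?F (X t) \<omega> = a + b * X s \<omega> + c * X u \<omega>"
    using h assms(2-6) unfolding harness_def by blast
  interpret sigma_finite_subalgebra M ?F
    unfolding outer_sigma_def by (intro sigma_finite_subalgebraI gen_subalgebra) auto
  have [measurable]: "X s \<in> borel_measurable M" "X t \<in> borel_measurable M" "X u \<in> borel_measurable M"
    using assms X_measurable by auto
  have "jacobi m n t = (if m = n then a else 0) + b * jacobi m n s + c * jacobi m n u" for m n
  proof (rule three_point_relation)
    fix m n
    define Z where "Z \<omega> = poly (p m s) (X s \<omega>) * poly (p n u) (X u \<omega>)" for \<omega>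
    have Z_M [measurable]: "Z \<in> borel_measurable M" unfolding Z_def by measurable
    have F_meas [measurable]: "X s \<in> borel_measurable ?F" "X u \<in> borel_measurable ?F"
      using assms unfolding outer_sigma_def by (auto intro!: measurable_gen_sigma)
    have Z_F: "Z \<in> borel_measurable ?F" unfolding Z_def by measurable
    have "integrable M (\<lambda>\<omega>. Z \<omega> * X t \<omega>)"
      unfolding Z_def using assms by (intro all_moments_integrable moments_intros)
    then have "(\<integral>\<omega>. Z \<omega> * X t \<omega> \<partial>M) = (\<integral>\<omega>. Z \<omega> * real_cond_exp M ?F (X t) \<omega> \<partial>M)"
      using Z_F by (intro real_cond_exp_intg(2)[symmetric]) auto
    also have "\<dots> = (\<integral>\<omega>. (a + b * X s \<omega> + c * X u \<omega>) * Z \<omega> \<partial>M)"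
    proof (rule integral_cong_AE)
      show "AE \<omega> in M. Z \<omega> * real_cond_exp M ?F (X t) \<omega> = (a + b * X s \<omega> + c * X u \<omega>) * Z \<omega>"
        using ae by eventually_elim simp
    qed measurable
    finally show "(\<integral>\<omega>. X t \<omega> * (poly (p m s) (X s \<omega>) * poly (p n u) (X u \<omega>)) \<partial>M) =
       (\<integral>\<omega>. (a + b * X s \<omega> + c * X u \<omega>) * (poly (p m s) (X s \<omega>) * poly (p n u) (X u \<omega>)) \<partial>M)"
      unfolding Z_def by (simp add: mult.commute)
  qed (use assms in auto)
  from recurrence_functions_relation[OF assms(2-4) this] show ?thesis by blast
qed

text \<open>If the vectors of \<open>\<alpha> 1\<close> and \<open>\<gamma> 0\<close> are
  independent at two times, the interpolation rule determines everything. Otherwise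
  \<open>sqnorm 1\<close> is constant and any two values of \<open>f\<close> are in the ratio of
  those of \<open>\<alpha> 1\<close>, so \<open>f\<close> is a multiple of
  \<open>\<alpha> 1\<close>.\<close>

lemma harness_imp_combination:
  assumes h: "harness M X I" and f: "f \<in> recurrence_functions"
  shows "\<exists>x y. \<forall>t\<in>I. f t = x * \<alpha> 1 t + y * \<gamma> 0 t"
proof (cases "\<exists>s0\<in>I. \<exists>u0\<in>I. s0 < u0 \<and> \<alpha> 1 s0 * \<gamma> 0 u0 \<noteq> \<alpha> 1 u0 * \<gamma> 0 s0")
  case True
  then obtain s0 u0 where su: "s0 \<in> I" "u0 \<in> I" "s0 < u0" "\<alpha> 1 s0 * \<gamma> 0 u0 \<noteq> \<alpha> 1 u0 * \<gamma> 0 s0" by blast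
  show ?thesis
    by (rule interpolation_imp_combination[OF harness_relation[OF h] _ _ su f])
      (auto simp: recurrence_functions_def)
next
  case False
  have a1: "\<alpha> 1 t \<noteq> 0" if "t \<in> I" for t using alpha_nonzero[OF that, of 0] by simp
  have const: "sqnorm 1 s = sqnorm 1 t" if "s \<in> I" "t \<in> I" "s < t" for s t
  proof -
    have "\<alpha> 1 s * \<gamma> 0 t = \<alpha> 1 t * \<gamma> 0 s" using False that by blast
    then show ?thesis using a1[OF that(1)] a1[OF that(2)] by (simp add: gamma_0 that)
  qed
  have rel: "\<exists>b. f t = b * f s \<and> \<alpha> 1 t = b * \<alpha> 1 s" if st: "s \<in> I" "t \<in> I" "s < t" for s t
  proof -
    obtain b where b: "\<And>g. g \<in> recurrence_functions \<Longrightarrow> g t = b * g s"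
      using degenerate_relation[OF st(1,2) less_imp_le[OF st(3)] const[OF st]] by blast
    have "\<alpha> 1 \<in> recurrence_functions" by (simp add: recurrence_functions_def)
    from b[OF f] b[OF this] show ?thesis by blast
  qed
  show ?thesis
  proof (cases "I = {}")
    case nonempty: False
    then obtain t0 where t0: "t0 \<in> I" by blast
    have "f t = f t0 / \<alpha> 1 t0 * \<alpha> 1 t + 0 * \<gamma> 0 t" if t: "t \<in> I" for t
    proof -
      consider "t = t0" | "t0 < t" | "t < t0" by linarith
      then show ?thesis
      proof cases
        case 1
        then show ?thesis using a1[OF t0] by simp
      next
        case 2
        from rel[OF t0 t 2] obtain b where "f t = b * f t0" "\<alpha> 1 t = b * \<alpha> 1 t0" by blast
        then show ?thesis using a1[OF t0] by simp
      next
        case 3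
        from rel[OF t t0 3] obtain b where "f t0 = b * f t" "\<alpha> 1 t0 = b * \<alpha> 1 t" by blast
        then show ?thesis using a1[OF t0] by simp
      qed
    qed
    then show ?thesis by blast
  qed simp
qed

section \<open>Passing from the present to the future by the Markov property\<close>

text \<open>The assumption \<open>zero\<close> says E(Y | X_w) = 0. For f an indicator of X_v,
  conditioning on the past of w, then the Markov property, then conditioning on X_w give E(Y f) =
  E(Y E(f | X_w)) = E(E(Y | X_w) E(f | X_w)) = 0.\<close>

lemma markov_step:
  fixes Y :: "'a \<Rightarrow> real"
  assumes w: "w \<in> I" and v: "v \<in> I" and "w \<le> v"
    and Y: "Y \<in> borel_measurable (past w)" "integrable M Y"
    and zero: "\<And>C. C \<in> sets borel \<Longrightarrow> (\<integral>\<omega>. Y \<omega> * indicator C (X w \<omega>) \<partial>M) = 0"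
    and C: "C \<in> sets borel"
  shows "(\<integral>\<omega>. Y \<omega> * indicator C (X v \<omega>) \<partial>M) = 0"
proof -
  let ?G = "gen_sigma M X {w}" and ?f = "\<lambda>\<omega>. indicator C (X v \<omega>) :: real"
  interpret P: sigma_finite_subalgebra M "past w" by (rule sigma_finite_subalgebraI[OF past_subalgebra])
  interpret G: sigma_finite_subalgebra M ?G using w by (intro sigma_finite_subalgebraI gen_subalgebra) simp
  have ae: "AE \<omega> in M. real_cond_exp M (past w) ?f \<omega> = real_cond_exp M ?G ?f \<omega>"
    using markov assms unfolding markov_process_def by blast
  have [measurable]: "X v \<in> borel_measurable M" "Y \<in> borel_measurable M" "C \<in> sets borel"
    using X_measurable[OF v] Y(2) C by auto
  have int: "integrable M (\<lambda>\<omega>. Y \<omega> * ?f \<omega>)"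
    by (rule Bochner_Integration.integrable_bound[OF Y(2)]) (auto simp: indicator_def)
  have Y_0: "AE \<omega> in M. real_cond_exp M ?G Y \<omega> = 0"
  proof (rule G.real_cond_exp_charact)
    fix A assume "A \<in> sets ?G"
    then obtain B where B: "A = X w -` B \<inter> space M" "B \<in> sets borel"
      unfolding sets_gen_sigma_singleton by blast
    have "(\<integral>\<omega>\<in>A. Y \<omega> \<partial>M) = (\<integral>\<omega>. Y \<omega> * indicator B (X w \<omega>) \<partial>M)"
      unfolding set_lebesgue_integral_def
      by (intro Bochner_Integration.integral_cong) (auto simp: B indicator_def)
    then show "(\<integral>\<omega>\<in>A. Y \<omega> \<partial>M) = (\<integral>\<omega>\<in>A. 0 \<partial>M)" using zero[OF B(2)] by simp
  qed (use Y(2) in auto)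
  have int': "integrable M (\<lambda>\<omega>. Y \<omega> * real_cond_exp M ?G ?f \<omega>)"
  proof -
    have "integrable M (\<lambda>\<omega>. Y \<omega> * real_cond_exp M (past w) ?f \<omega>)"
      using int Y(1) by (intro P.real_cond_exp_intg(1)) auto
    moreover have "AE \<omega> in M. Y \<omega> * real_cond_exp M (past w) ?f \<omega> = Y \<omega> * real_cond_exp M ?G ?f \<omega>"
      using ae by eventually_elim simp
    ultimately show ?thesis by (subst integrable_cong_AE[symmetric]) auto
  qed
  have "(\<integral>\<omega>. Y \<omega> * ?f \<omega> \<partial>M) = (\<integral>\<omega>. Y \<omega> * real_cond_exp M (past w) ?f \<omega> \<partial>M)"
    using int Y(1) by (intro P.real_cond_exp_intg(2)[symmetric]) auto
  also have "\<dots> = (\<integral>\<omega>. real_cond_exp M ?G ?f \<omega> * Y \<omega> \<partial>M)"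
  proof (rule integral_cong_AE)
    show "AE \<omega> in M. Y \<omega> * real_cond_exp M (past w) ?f \<omega> = real_cond_exp M ?G ?f \<omega> * Y \<omega>"
      using ae by eventually_elim simp
  qed measurable
  also have "\<dots> = (\<integral>\<omega>. real_cond_exp M ?G ?f \<omega> * real_cond_exp M ?G Y \<omega> \<partial>M)"
    using int' by (intro G.real_cond_exp_intg(2)[symmetric]) (auto simp: mult.commute)
  also have "\<dots> = (\<integral>\<omega>. 0 \<partial>M)"
  proof (rule integral_cong_AE)
    show "AE \<omega> in M. real_cond_exp M ?G ?f \<omega> * real_cond_exp M ?G Y \<omega> = 0"
      using Y_0 by eventually_elim simp
  qed measurable
  finally show ?thesis by simp
qed

text \<open>The times of \<open>J\<close> are added in increasing order. The product of
  \<open>Y\<close> with the indicators used so far is measurable in the past of the last time and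
  orthogonal to the value there, which is what \<open>markov_step\<close> needs to reach the next
  time.\<close>

lemma future_cylinder:
  fixes Y :: "'a \<Rightarrow> real"
  assumes u: "u \<in> I" and Y: "Y \<in> borel_measurable (past u)" "integrable M Y"
    and zero: "\<And>C. C \<in> sets borel \<Longrightarrow> (\<integral>\<omega>. Y \<omega> * indicator C (X u \<omega>) \<partial>M) = 0"
    and J: "finite J" "J \<subseteq> {v \<in> I. u \<le> v}" and B: "\<And>v. B v \<in> sets borel"
  shows "(\<integral>\<omega>. Y \<omega> * indicator {\<omega>. \<forall>v\<in>J. X v \<omega> \<in> B v} \<omega> \<partial>M) = 0"
proof -
  define YJ where "YJ J \<omega> = Y \<omega> * indicator {\<omega>. \<forall>v\<in>J. X v \<omega> \<in> B v} \<omega>" for J \<omega>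
  \<comment> \<open>The first clause says that \<open>w\<close> does not exceed the maximum of
    \<open>u\<close> and \<open>J\<close>, in a form that also covers empty \<open>J\<close>; the
    next time to be added then lies at or after \<open>w\<close>.\<close>
  have "\<exists>w\<in>I. (\<forall>b. (\<forall>v\<in>insert u J. v \<le> b) \<longrightarrow> w \<le> b) \<and>
      YJ J \<in> borel_measurable (past w) \<and> integrable M (YJ J) \<and>
      (\<forall>C\<in>sets borel. (\<integral>\<omega>. YJ J \<omega> * indicator C (X w \<omega>) \<partial>M) = 0)"
    using J
  proof (induction J rule: finite_linorder_max_induct)
    case empty
    have "YJ {} = Y" by (simp add: YJ_def fun_eq_iff)
    then show ?case using u Y zero by (intro bexI[of _ u]) auto
  next
    case (insert b J)
    have "J \<subseteq> {v \<in> I. u \<le> v}" using insert.prems by auto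
    from insert.IH[OF this] obtain w where w: "w \<in> I" "\<forall>b. (\<forall>v\<in>insert u J. v \<le> b) \<longrightarrow> w \<le> b"
        "YJ J \<in> borel_measurable (past w)" "integrable M (YJ J)"
        "\<forall>C\<in>sets borel. (\<integral>\<omega>. YJ J \<omega> * indicator C (X w \<omega>) \<partial>M) = 0"
      by (elim bexE conjE) (rule that)
    have b: "b \<in> I" "u \<le> b" using insert.prems by auto
    have wb: "w \<le> b" using w(2) insert.hyps(2) b(2) by (auto intro: less_imp_le)
    have eq: "YJ (insert b J) = (\<lambda>\<omega>. YJ J \<omega> * indicator (B b) (X b \<omega>))"
      by (auto simp: YJ_def indicator_def fun_eq_iff)
    have meas: "YJ J \<in> borel_measurable (past b)" "X b \<in> borel_measurable (past b)" "B b \<in> sets borel"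
      using past_measurable_mono[OF w(3) wb] X_past[OF b(1)] B by auto
    show ?case
    proof (intro bexI[of _ b] conjI ballI allI impI)
      show "b \<le> b'" if "\<forall>v\<in>insert u (insert b J). v \<le> b'" for b' using that by simp
      show "YJ (insert b J) \<in> borel_measurable (past b)" unfolding eq using meas by measurable
      have [measurable]: "X b \<in> borel_measurable M" "B b \<in> sets borel" "YJ J \<in> borel_measurable M"
        using X_measurable[OF b(1)] B w(4) by auto
      show "integrable M (YJ (insert b J))" unfolding eq
        by (rule Bochner_Integration.integrable_bound[OF w(4)]) (auto simp: indicator_def)
      fix C :: "real set" assume C: "C \<in> sets borel"
      \<comment> \<open>The new indicator and the test set \<open>C\<close> concern the same
        variable \<open>X b\<close>, so they merge into one Borel set.\<close>
      have "(\<integral>\<omega>. YJ J \<omega> * indicator (B b \<inter> C) (X b \<omega>) \<partial>M) = 0"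
        using w(5) B C by (intro markov_step[OF w(1) b(1) wb w(3,4)]) auto
      then show "(\<integral>\<omega>. YJ (insert b J) \<omega> * indicator C (X b \<omega>) \<partial>M) = 0"
        unfolding eq by (simp add: indicator_inter_arith mult.assoc)
    qed (rule b(1))
  qed
  then obtain w where "\<forall>C\<in>sets borel. (\<integral>\<omega>. YJ J \<omega> * indicator C (X w \<omega>) \<partial>M) = 0" by blast
  from bspec[OF this, of UNIV] show ?thesis by (simp add: YJ_def)
qed

text \<open>Powers are combinations of the polynomials \<open>p i u\<close>, so \<open>Y\<close> is
  orthogonal to all of them, and M. Riesz's theorem applies to the determinate law of
  \<open>X u\<close>.\<close>

lemma orthogonal_past_present:
  assumes u: "u \<in> I" and Y: "all_moments M Y"
    and orth: "\<And>n. (\<integral>\<omega>. Y \<omega> * poly (p n u) (X u \<omega>) \<partial>M) = 0"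
    and C: "C \<in> sets borel"
  shows "(\<integral>\<omega>. Y \<omega> * indicator C (X u \<omega>) \<partial>M) = 0"
proof -
  interpret L: determinate_orthogonal_polynomials "law M X u" "\<lambda>n. p n u" by (rule determinate_law[OF u])
  interpret S: square_integrable_orthogonal "law M X u" "\<lambda>n. p n u" M "X u" Y
  proof
    show "X u \<in> borel_measurable M" by (rule X_measurable[OF u])
    show "distr M borel (X u) = law M X u" by (simp add: law_def)
    show "Y \<in> borel_measurable M" "integrable M (\<lambda>\<omega>. (Y \<omega>)\<^sup>2)" using Y by (auto simp: all_moments_def)
    fix m
    obtain c where c: "monom 1 m = (\<Sum>i\<le>m. smult (c i) (p i u))"
      by (rule poly_expansion[OF L.deg_p L.p_nonzero degree_monom_le])
    have "X u \<omega> ^ m = poly (monom 1 m) (X u \<omega>)" for \<omega> by (simp add: poly_monom)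
    then have "Y \<omega> * X u \<omega> ^ m = (\<Sum>i\<le>m. c i * (Y \<omega> * poly (p i u) (X u \<omega>)))" for \<omega>
      unfolding c by (simp add: poly_sum sum_distrib_left mult_ac)
    moreover have "integrable M (\<lambda>\<omega>. Y \<omega> * poly (p i u) (X u \<omega>))" for i
      using u Y by (intro all_moments_integrable moments_intros)
    ultimately show "(\<integral>\<omega>. Y \<omega> * X u \<omega> ^ m \<partial>M) = 0" by (simp add: orth)
  qed
  show ?thesis by (rule S.orth_indicator[OF C])
qed

section \<open>From the linear form of the coefficients to a harness\<close>

text \<open>The residual \<open>W\<close> must integrate to zero over every event outside the gap
  between \<open>s\<close> and \<open>u\<close>. By Dynkin's argument it is enough to treat an event
  of the past of \<open>s\<close> intersected with a cylinder of the future of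
  \<open>u\<close>.\<close>

lemma relation_imp_conditional_expectation:
  assumes s: "s \<in> I" and t: "t \<in> I" and u: "u \<in> I" and st: "s < t" and tu: "t < u"
    and rel_\<alpha>: "\<And>n. \<alpha> n t = b * \<alpha> n s + c * \<alpha> n u"
    and rel_\<beta>: "\<And>n. \<beta> n t = a + b * \<beta> n s + c * \<beta> n u"
    and rel_\<gamma>: "\<And>n. \<gamma> n t = b * \<gamma> n s + c * \<gamma> n u"
  shows "AE \<omega> in M. real_cond_exp M (outer_sigma M X I s u) (X t) \<omega> = a + b * X s \<omega> + c * X u \<omega>"
proof -
  let ?F = "outer_sigma M X I s u"
  define W where "W \<omega> = X t \<omega> - (a + b * X s \<omega> + c * X u \<omega>)" for \<omega>
  have W_am: "all_moments M W" unfolding W_def[abs_def] using s t u by (intro moments_intros)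
  have F_sub: "subalgebra M ?F" unfolding outer_sigma_def by (intro gen_subalgebra) auto
  interpret F: sigma_finite_subalgebra M ?F by (rule sigma_finite_subalgebraI[OF F_sub])
  have past_cylinder: "(\<integral>\<omega>. W \<omega> * indicator A \<omega> * indicator {\<omega>. \<forall>v\<in>J. X v \<omega> \<in> B v} \<omega> \<partial>M) = 0"
    if A: "A \<in> sets (past s)" and J: "finite J" "J \<subseteq> {v \<in> I. u \<le> v}" and B: "\<And>v. B v \<in> sets borel" for A J B
  proof -
    define Y where "Y \<omega> = W \<omega> * indicator A \<omega>" for \<omega>
    have A_M: "A \<in> sets M" using A past_subalgebra[of s] by (auto simp: subalgebra_def)
    have ind_am: "all_moments M (indicator A)" by (rule all_moments_indicator[OF A_M])
    have ind_meas: "(indicator A :: 'a \<Rightarrow> real) \<in> borel_measurable (past s)" using A by simp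
    have Y_am: "all_moments M Y" unfolding Y_def[abs_def] by (intro moments_intros W_am ind_am)
    have Y_meas: "Y \<in> borel_measurable (past u)"
    proof -
      have [measurable]: "X s \<in> borel_measurable (past u)" "X t \<in> borel_measurable (past u)"
        "X u \<in> borel_measurable (past u)" "(indicator A :: 'a \<Rightarrow> real) \<in> borel_measurable (past u)"
        using s t u st tu past_measurable_mono[OF ind_meas, of u] by (auto intro: X_past)
      show ?thesis unfolding Y_def[abs_def] W_def by measurable
    qed
    have orth: "(\<integral>\<omega>. Y \<omega> * poly (p n u) (X u \<omega>) \<partial>M) = 0" for n
    proof -
      \<comment> \<open>The terms with \<open>X t\<close>, \<open>X s\<close> and \<open>X u\<close>
        become recurrence sums at the times \<open>t\<close>, \<open>s\<close> and \<open>u\<close>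
        over the same numbers \<open>e k\<close>, so the relations between the coefficients cancel
        them together with the constant term.\<close>
      define e where "e k = (\<integral>\<omega>. indicator A \<omega> * poly (p k s) (X s \<omega>) \<partial>M)" for k
      have su: "s \<le> u" using st tu by simp
      have [measurable]: "X s \<in> borel_measurable (past s)" "X t \<in> borel_measurable (past t)"
        "(indicator A :: 'a \<Rightarrow> real) \<in> borel_measurable (past s)" "(indicator A :: 'a \<Rightarrow> real) \<in> borel_measurable (past t)"
        using s t st past_measurable_mono[OF ind_meas, of t] ind_meas by (auto intro: X_past)
      have e_t: "(\<integral>\<omega>. indicator A \<omega> * X t \<omega> * poly (p n u) (X u \<omega>) \<partial>M) =
          \<alpha> (Suc n) t * e (Suc n) + \<beta> n t * e n + (if n = 0 then 0 else \<gamma> (n - 1) t * e (n - 1))"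
      proof -
        have "(\<lambda>\<omega>. indicator A \<omega> * X t \<omega>) \<in> borel_measurable (past t)" by measurable
        then have "(\<integral>\<omega>. indicator A \<omega> * X t \<omega> * poly (p n u) (X u \<omega>) \<partial>M) =
            (\<integral>\<omega>. indicator A \<omega> * X t \<omega> * poly (p n t) (X t \<omega>) \<partial>M)"
          using t u tu by (intro martingale moments_intros ind_am) auto
        then show ?thesis
          unfolding e_def using recurrence_expectation[OF s t less_imp_le[OF st] ind_meas ind_am, of n] by simp
      qed
      have e_u: "(\<integral>\<omega>. indicator A \<omega> * X u \<omega> * poly (p n u) (X u \<omega>) \<partial>M) =
          \<alpha> (Suc n) u * e (Suc n) + \<beta> n u * e n + (if n = 0 then 0 else \<gamma> (n - 1) u * e (n - 1))"
        unfolding e_def by (rule recurrence_expectation[OF s u su ind_meas ind_am])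
      have e_s: "(\<integral>\<omega>. indicator A \<omega> * X s \<omega> * poly (p n u) (X u \<omega>) \<partial>M) =
          \<alpha> (Suc n) s * e (Suc n) + \<beta> n s * e n + (if n = 0 then 0 else \<gamma> (n - 1) s * e (n - 1))"
      proof -
        have "(\<lambda>\<omega>. indicator A \<omega> * X s \<omega>) \<in> borel_measurable (past s)" by measurable
        then have "(\<integral>\<omega>. indicator A \<omega> * X s \<omega> * poly (p n u) (X u \<omega>) \<partial>M) =
            (\<integral>\<omega>. indicator A \<omega> * X s \<omega> * poly (p n s) (X s \<omega>) \<partial>M)"
          using s u su by (intro martingale moments_intros ind_am) auto
        then show ?thesis
          unfolding e_def using recurrence_expectation[OF s s order.refl ind_meas ind_am, of n] by simp
      qed
      have e_1: "(\<integral>\<omega>. indicator A \<omega> * poly (p n u) (X u \<omega>) \<partial>M) = e n"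
        unfolding e_def by (rule martingale[OF s u su ind_meas ind_am])
      have int: "integrable M (\<lambda>\<omega>. indicator A \<omega> * X t \<omega> * poly (p n u) (X u \<omega>))"
        "integrable M (\<lambda>\<omega>. indicator A \<omega> * X s \<omega> * poly (p n u) (X u \<omega>))"
        "integrable M (\<lambda>\<omega>. indicator A \<omega> * X u \<omega> * poly (p n u) (X u \<omega>))"
        "integrable M (\<lambda>\<omega>. indicator A \<omega> * poly (p n u) (X u \<omega>))"
        using s t u by (intro all_moments_integrable moments_intros ind_am; simp)+
      have "Y \<omega> * poly (p n u) (X u \<omega>) = indicator A \<omega> * X t \<omega> * poly (p n u) (X u \<omega>)
          - (a * (indicator A \<omega> * poly (p n u) (X u \<omega>)) + b * (indicator A \<omega> * X s \<omega> * poly (p n u) (X u \<omega>))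
            + c * (indicator A \<omega> * X u \<omega> * poly (p n u) (X u \<omega>)))" for \<omega>
        by (simp add: Y_def W_def algebra_simps)
      then have "(\<integral>\<omega>. Y \<omega> * poly (p n u) (X u \<omega>) \<partial>M) =
          (\<integral>\<omega>. indicator A \<omega> * X t \<omega> * poly (p n u) (X u \<omega>) \<partial>M)
          - (a * (\<integral>\<omega>. indicator A \<omega> * poly (p n u) (X u \<omega>) \<partial>M)
            + b * (\<integral>\<omega>. indicator A \<omega> * X s \<omega> * poly (p n u) (X u \<omega>) \<partial>M)
            + c * (\<integral>\<omega>. indicator A \<omega> * X u \<omega> * poly (p n u) (X u \<omega>) \<partial>M))"
        using int by simp
      also have "\<dots> = 0"
        unfolding e_t e_s e_u e_1 rel_\<alpha>[of "Suc n"] rel_\<beta>[of n] rel_\<gamma>[of "n - 1"]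
        by (simp add: algebra_simps)
      finally show ?thesis .
    qed
    show ?thesis
      using future_cylinder[OF u Y_meas all_moments_integrable[OF Y_am]
          orthogonal_past_present[OF u Y_am orth] J B]
      by (simp add: Y_def)
  qed
  \<comment> \<open>Past events need no cylinder structure, as \<open>past_cylinder\<close> treats
    arbitrary ones; only the future part is restricted to finitely many times.\<close>
  define G where "G = {A \<inter> {\<omega> \<in> space M. \<forall>v\<in>J. X v \<omega> \<in> B v} | A J B.
      A \<in> sets (past s) \<and> finite J \<and> J \<subseteq> {v \<in> I. u \<le> v} \<and> (\<forall>v. B v \<in> sets borel)}"
  have G_memI: "A \<inter> {\<omega> \<in> space M. \<forall>v\<in>J. X v \<omega> \<in> B v} \<in> G"
    if "A \<in> sets (past s)" "finite J" "J \<subseteq> {v \<in> I. u \<le> v}" "\<And>v. B v \<in> sets borel" for A J B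
    using that unfolding G_def by blast
  have G_memD: "\<exists>A' J B. A = A' \<inter> {\<omega> \<in> space M. \<forall>v\<in>J. X v \<omega> \<in> B v} \<and>
      A' \<in> sets (past s) \<and> finite J \<and> J \<subseteq> {v \<in> I. u \<le> v} \<and> (\<forall>v. B v \<in> sets borel)" if "A \<in> G" for A
    using that unfolding G_def mem_Collect_eq .
  have past_M: "A \<in> sets M" if "A \<in> sets (past s)" for A
    using that past_subalgebra[of s] by (auto simp: subalgebra_def)
  have G_zero: "(\<integral>\<omega>\<in>A. W \<omega> \<partial>M) = 0" if "A \<in> G" for A
  proof -
    from G_memD[OF that] obtain A' J B where A: "A = A' \<inter> {\<omega> \<in> space M. \<forall>v\<in>J. X v \<omega> \<in> B v}"
      "A' \<in> sets (past s)" "finite J" "J \<subseteq> {v \<in> I. u \<le> v}" "\<forall>v. B v \<in> sets borel" by blast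
    have "(\<integral>\<omega>\<in>A. W \<omega> \<partial>M) = (\<integral>\<omega>. W \<omega> * indicator A' \<omega> * indicator {\<omega>. \<forall>v\<in>J. X v \<omega> \<in> B v} \<omega> \<partial>M)"
      unfolding set_lebesgue_integral_def A(1)
      by (intro Bochner_Integration.integral_cong) (auto simp: indicator_def)
    then show ?thesis using past_cylinder[OF A(2-4), of B] A(5) by simp
  qed
  have top_past: "space M \<in> sets (past s)" using sets.top[of "past s"] by simp
  have "(\<integral>\<omega>. W \<omega> \<partial>M) = (\<integral>\<omega>. W \<omega> * indicator (space M) \<omega> * indicator {\<omega>. \<forall>v\<in>{}. X v \<omega> \<in> UNIV} \<omega> \<partial>M)"
    by (intro Bochner_Integration.integral_cong) auto
  also have "\<dots> = 0" by (rule past_cylinder[OF top_past]) auto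
  finally have W_0: "(\<integral>\<omega>. W \<omega> \<partial>M) = 0" .
  have G_sets: "G \<subseteq> sets M"
  proof
    fix A assume "A \<in> G"
    from G_memD[OF this] obtain A' J B where A: "A = A' \<inter> {\<omega> \<in> space M. \<forall>v\<in>J. X v \<omega> \<in> B v}"
      "A' \<in> sets (past s)" "finite J" "J \<subseteq> {v \<in> I. u \<le> v}" "\<forall>v. B v \<in> sets borel" by blast
    have "{\<omega> \<in> space M. \<forall>v\<in>J. X v \<omega> \<in> B v} \<in> sets M"
    proof (rule sets.sets_Collect_finite_All[OF _ A(3)])
      fix v assume "v \<in> J"
      then have "X v \<in> borel_measurable M" using A(4) by (auto intro: X_measurable)
      then show "{\<omega> \<in> space M. X v \<omega> \<in> B v} \<in> sets M" using A(5) by measurable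
    qed
    then show "A \<in> sets M" unfolding A(1) using past_M[OF A(2)] by blast
  qed
  have G_stable: "Int_stable G"
  proof (rule Int_stableI)
    fix A1 A2 assume G12: "A1 \<in> G" "A2 \<in> G"
    from G_memD[OF G12(1)] obtain A J B where A: "A1 = A \<inter> {\<omega> \<in> space M. \<forall>v\<in>J. X v \<omega> \<in> B v}"
      "A \<in> sets (past s)" "finite J" "J \<subseteq> {v \<in> I. u \<le> v}" "\<forall>v. B v \<in> sets borel" by blast
    from G_memD[OF G12(2)] obtain A' J' B' where A': "A2 = A' \<inter> {\<omega> \<in> space M. \<forall>v\<in>J'. X v \<omega> \<in> B' v}"
      "A' \<in> sets (past s)" "finite J'" "J' \<subseteq> {v \<in> I. u \<le> v}" "\<forall>v. B' v \<in> sets borel" by blast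
    \<comment> \<open>Extending each family by \<open>UNIV\<close> off its own index set lets both
      cylinders be read over the union of the index sets.\<close>
    define C where "C v = (if v \<in> J then B v else UNIV) \<inter> (if v \<in> J' then B' v else UNIV)" for v
    have "A1 \<inter> A2 = (A \<inter> A') \<inter> {\<omega> \<in> space M. \<forall>v\<in>J \<union> J'. X v \<omega> \<in> C v}"
      unfolding A(1) A'(1) by (auto simp: C_def)
    also have "\<dots> \<in> G"
      using A A' by (intro G_memI) (auto simp: C_def)
    finally show "A1 \<inter> A2 \<in> G" .
  qed
  have F_sets: "sets ?F \<subseteq> sigma_sets (space M) G"
    unfolding outer_sigma_def sets_gen_sigma
  proof (rule sigma_sets_mono, rule subsetI)
    fix A assume "A \<in> {X v -` B \<inter> space M |v B. v \<in> {v \<in> I. v \<notin> {s<..<u}} \<and> B \<in> sets borel}"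
    then obtain v B where v: "A = X v -` B \<inter> space M" "v \<in> I" "v \<le> s \<or> u \<le> v" "B \<in> sets borel" by auto
    have "A \<in> G"
    proof (cases "u \<le> v")
      case True
      have "A = space M \<inter> {\<omega> \<in> space M. \<forall>v\<in>{v}. X v \<omega> \<in> B}" unfolding v(1) by auto
      also have "\<dots> \<in> G" using top_past True v by (intro G_memI) auto
      finally show ?thesis .
    next
      case False
      then have "X v \<in> borel_measurable (past s)" using v by (intro X_past) auto
      then have "A \<in> sets (past s)" unfolding v(1) using v(4) measurable_sets[of "X v" "past s" borel B] by simp
      then have "A \<inter> {\<omega> \<in> space M. \<forall>v\<in>{}. X v \<omega> \<in> UNIV} \<in> G" by (intro G_memI) auto
      moreover have "A \<inter> {\<omega> \<in> space M. \<forall>v\<in>{}. X v \<omega> \<in> UNIV} = A" unfolding v(1) by auto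
      ultimately show ?thesis by simp
    qed
    then show "A \<in> sigma_sets (space M) G" by (rule sigma_sets.Basic)
  qed
  show ?thesis
  proof (rule F.real_cond_exp_charact)
    have X_int: "integrable M (X t)" "integrable M (\<lambda>\<omega>. a + b * X s \<omega> + c * X u \<omega>)"
      using s t u by (intro all_moments_integrable moments_intros; simp)+
    then show "integrable M (X t)" "integrable M (\<lambda>\<omega>. a + b * X s \<omega> + c * X u \<omega>)" by auto
    have [measurable]: "X s \<in> borel_measurable ?F" "X u \<in> borel_measurable ?F"
      using s u st tu unfolding outer_sigma_def by (auto intro!: measurable_gen_sigma)
    show "(\<lambda>\<omega>. a + b * X s \<omega> + c * X u \<omega>) \<in> borel_measurable ?F" by measurable
    fix A assume A: "A \<in> sets ?F"
    then have A_M: "A \<in> sets M" using F_sub by (auto simp: subalgebra_def)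
    have "(\<integral>\<omega>\<in>A. W \<omega> \<partial>M) = 0"
      using F_sets A by (intro set_integral_zero_sigma_sets[OF all_moments_integrable[OF W_am] W_0 G_stable G_sets G_zero]) auto
    moreover have "(\<integral>\<omega>\<in>A. W \<omega> \<partial>M) = (\<integral>\<omega>\<in>A. X t \<omega> \<partial>M) - (\<integral>\<omega>\<in>A. a + b * X s \<omega> + c * X u \<omega> \<partial>M)"
      unfolding W_def set_integrable_def
      by (intro set_integral_diff(2)) (simp_all only: set_integrable_def integrable_mult_indicator[OF A_M] X_int)
    ultimately show "(\<integral>\<omega>\<in>A. X t \<omega> \<partial>M) = (\<integral>\<omega>\<in>A. a + b * X s \<omega> + c * X u \<omega> \<partial>M)" by simp
  qed
qed

text \<open>If \<open>sqnorm 1\<close> agrees at \<open>s\<close> and \<open>u\<close>, by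
  monotonicity it agrees at \<open>t\<close> too, and \<open>X t\<close> is affine in
  \<open>X s\<close> alone. Otherwise \<open>b\<close> and \<open>c\<close> can be solved for from
  \<open>\<alpha> 1\<close> and \<open>\<gamma> 0\<close>, and linearity spreads the relation to all
  recurrence functions.\<close>

lemma combination_imp_harness:
  assumes comb: "\<And>f. f \<in> recurrence_functions \<Longrightarrow> \<exists>x y. \<forall>t\<in>I. f t = x * \<alpha> 1 t + y * \<gamma> 0 t"
  shows "harness M X I"
  unfolding harness_def
proof (intro ballI impI)
  fix s t u assume I: "s \<in> I" "t \<in> I" "u \<in> I" and "s < t \<and> t < u"
  then have st: "s < t" and tu: "t < u" by auto
  have a1: "\<alpha> 1 v \<noteq> 0" if "v \<in> I" for v using alpha_nonzero[OF that, of 0] by simp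
  show "\<exists>a b c. AE \<omega> in M. real_cond_exp M (outer_sigma M X I s u) (X t) \<omega> = a + b * X s \<omega> + c * X u \<omega>"
  proof (cases "sqnorm 1 s = sqnorm 1 u")
    case True
    have "sqnorm 1 s = sqnorm 1 t"
      using True sqnorm_1_mono[OF I(1,2)] sqnorm_1_mono[OF I(2,3)] st tu by simp
    from degenerate_affine[OF I(1,2) less_imp_le[OF st] this]
    obtain A B where ae: "AE \<omega> in M. X t \<omega> = A + B * X s \<omega>" by blast
    interpret F: sigma_finite_subalgebra M "outer_sigma M X I s u"
      unfolding outer_sigma_def by (intro sigma_finite_subalgebraI gen_subalgebra) auto
    have F_meas [measurable]: "X s \<in> borel_measurable (outer_sigma M X I s u)"
      using I st unfolding outer_sigma_def by (auto intro!: measurable_gen_sigma)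
    have "AE \<omega> in M. real_cond_exp M (outer_sigma M X I s u) (X t) \<omega> =
        real_cond_exp M (outer_sigma M X I s u) (\<lambda>\<omega>. A + B * X s \<omega>) \<omega>"
    proof (rule F.real_cond_exp_cong[OF ae X_measurable[OF I(2)]])
      show "(\<lambda>\<omega>. A + B * X s \<omega>) \<in> borel_measurable M" using X_measurable[OF I(1)] by measurable
    qed
    moreover have "AE \<omega> in M. real_cond_exp M (outer_sigma M X I s u) (\<lambda>\<omega>. A + B * X s \<omega>) \<omega> = A + B * X s \<omega>"
    proof (rule F.real_cond_exp_F_meas)
      show "integrable M (\<lambda>\<omega>. A + B * X s \<omega>)" using I by (intro all_moments_integrable moments_intros)
    qed measurable
    ultimately have "AE \<omega> in M. real_cond_exp M (outer_sigma M X I s u) (X t) \<omega> = A + B * X s \<omega> + 0 * X u \<omega>"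
      by eventually_elim simp
    then show ?thesis by blast
  next
    case False
    define D where "D = \<alpha> 1 s * \<gamma> 0 u - \<alpha> 1 u * \<gamma> 0 s"
    \<comment> \<open>Since \<open>\<gamma> 0\<close> is \<open>\<alpha> 1\<close> times
      \<open>sqnorm 1\<close>, the determinant vanishes only in the degenerate case.\<close>
    have "D = \<alpha> 1 s * \<alpha> 1 u * (sqnorm 1 u - sqnorm 1 s)"
      using I by (simp add: D_def gamma_0 algebra_simps)
    then have D: "D \<noteq> 0" using False a1 I by simp
    \<comment> \<open>Cramer's rule for the two relations \<open>v\<close> and \<open>w\<close>
      below.\<close>
    define b c where "b = (\<alpha> 1 t * \<gamma> 0 u - \<alpha> 1 u * \<gamma> 0 t) / D" and "c = (\<alpha> 1 s * \<gamma> 0 t - \<alpha> 1 t * \<gamma> 0 s) / D"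
    have v: "\<alpha> 1 t = b * \<alpha> 1 s + c * \<alpha> 1 u"
    proof -
      have "D * \<alpha> 1 t = (\<alpha> 1 t * \<gamma> 0 u - \<alpha> 1 u * \<gamma> 0 t) * \<alpha> 1 s + (\<alpha> 1 s * \<gamma> 0 t - \<alpha> 1 t * \<gamma> 0 s) * \<alpha> 1 u"
        by (simp only: D_def) (simp add: algebra_simps)
      then show ?thesis using D by (simp add: b_def c_def eq_divide_eq mult.commute flip: add_divide_distrib)
    qed
    have w: "\<gamma> 0 t = b * \<gamma> 0 s + c * \<gamma> 0 u"
    proof -
      have "D * \<gamma> 0 t = (\<alpha> 1 t * \<gamma> 0 u - \<alpha> 1 u * \<gamma> 0 t) * \<gamma> 0 s + (\<alpha> 1 s * \<gamma> 0 t - \<alpha> 1 t * \<gamma> 0 s) * \<gamma> 0 u"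
        by (simp only: D_def) (simp add: algebra_simps)
      then show ?thesis using D by (simp add: b_def c_def eq_divide_eq mult.commute flip: add_divide_distrib)
    qed
    have rel: "f t = b * f s + c * f u" if f: "f \<in> recurrence_functions" for f
    proof -
      obtain x y where xy: "\<And>t. t \<in> I \<Longrightarrow> f t = x * \<alpha> 1 t + y * \<gamma> 0 t" using comb[OF f] by blast
      have "f t = x * (b * \<alpha> 1 s + c * \<alpha> 1 u) + y * (b * \<gamma> 0 s + c * \<gamma> 0 u)"
        using xy[OF I(2)] v w by simp
      also have "\<dots> = b * f s + c * f u" using xy[OF I(1)] xy[OF I(3)] by (simp add: algebra_simps)
      finally show ?thesis .
    qed
    \<comment> \<open>The constant is fixed by the relation for \<open>\<beta> 0\<close>; the
      differences from \<open>\<beta> 0\<close> then give the relation for every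
      \<open>\<beta> n\<close>.\<close>
    have "AE \<omega> in M. real_cond_exp M (outer_sigma M X I s u) (X t) \<omega> =
        (\<beta> 0 t - b * \<beta> 0 s - c * \<beta> 0 u) + b * X s \<omega> + c * X u \<omega>"
    proof (rule relation_imp_conditional_expectation[OF I st tu])
      show "\<alpha> n t = b * \<alpha> n s + c * \<alpha> n u" for n by (rule rel) (simp add: recurrence_functions_def)
      show "\<gamma> n t = b * \<gamma> n s + c * \<gamma> n u" for n by (rule rel) (simp add: recurrence_functions_def)
      show "\<beta> n t = (\<beta> 0 t - b * \<beta> 0 s - c * \<beta> 0 u) + b * \<beta> n s + c * \<beta> n u" for n
        using rel[of "\<lambda>t. \<beta> n t - \<beta> 0 t"] by (simp add: recurrence_functions_def algebra_simps)
    qed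
    then show ?thesis by blast
  qed
qed

end

section \<open>The characterisation of harnesses\<close>

theorem theorem3:
  fixes M :: "'a measure" and X :: "real \<Rightarrow> 'a \<Rightarrow> real" and I :: "real set"
    and p :: "nat \<Rightarrow> real \<Rightarrow> real poly"
    and \<alpha> \<beta> \<gamma> :: "nat \<Rightarrow> real \<Rightarrow> real"
  assumes I: "is_interval I"
    and opm: "OPM M X I p"
    and trans: "\<exists>\<eta>. transition_kernel M X I \<eta> \<and>
       (\<forall>s\<in>I. \<forall>t\<in>I. s < t \<longrightarrow> (\<forall>y\<in>measure_support (law M X s).
          absolutely_continuous (law M X t) (\<eta> t y s) \<and>
          integrable (law M X t) (\<lambda>x. (enn2real (RN_deriv (law M X t) (\<eta> t y s) x))\<^sup>2)))"
    and alpha0: "\<forall>t\<in>I. \<alpha> 0 t = 0"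
    and rec: "\<forall>t\<in>I. \<forall>n x. x * poly (p n t) x =
       \<alpha> (Suc n) t * poly (p (Suc n) t) x + \<beta> n t * poly (p n t) x
       + (if n = 0 then 0 else \<gamma> (n - 1) t * poly (p (n - 1) t) x)"
  shows "harness M X I \<longleftrightarrow>
    (\<exists>a ah b bh c ch :: nat \<Rightarrow> real.
       b 0 = 0 \<and> bh 0 = 0 \<and> ah 0 = 0 \<and> a 0 = 0 \<and> ah 1 = 0 \<and> c 0 = 0 \<and>
       a 1 = 1 \<and> ch 0 = 1 \<and>
       (\<forall>n. \<forall>t\<in>I.
          \<beta> n t = \<beta> 0 t + b n * \<alpha> 1 t + bh n * \<gamma> 0 t \<and>
          \<alpha> n t = a n * \<alpha> 1 t + ah n * \<gamma> 0 t \<and>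
          \<gamma> n t = c n * \<alpha> 1 t + ch n * \<gamma> 0 t) \<and>
       (\<forall>t\<in>I. \<forall>n\<ge>1. \<alpha> n t * \<gamma> (n - 1) t > 0))"
proof -
  interpret opm_recurrence M X I p \<alpha> \<beta> \<gamma>
    using opm alpha0 rec by unfold_locales auto
  show ?thesis
  proof
    assume h: "harness M X I"
    have "\<exists>x y. \<forall>t\<in>I. \<alpha> n t = x * \<alpha> 1 t + y * \<gamma> 0 t" for n
      by (rule harness_imp_combination[OF h]) (simp add: recurrence_functions_def)
    then obtain a ah where a: "\<forall>t\<in>I. \<alpha> n t = a n * \<alpha> 1 t + ah n * \<gamma> 0 t" for n by metis
    have "\<exists>x y. \<forall>t\<in>I. \<gamma> n t = x * \<alpha> 1 t + y * \<gamma> 0 t" for n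
      by (rule harness_imp_combination[OF h]) (simp add: recurrence_functions_def)
    then obtain c ch where c: "\<forall>t\<in>I. \<gamma> n t = c n * \<alpha> 1 t + ch n * \<gamma> 0 t" for n by metis
    have "\<exists>x y. \<forall>t\<in>I. \<beta> n t - \<beta> 0 t = x * \<alpha> 1 t + y * \<gamma> 0 t" for n
      by (rule harness_imp_combination[OF h, of "\<lambda>t. \<beta> n t - \<beta> 0 t"]) (simp add: recurrence_functions_def)
    then obtain b bh where b: "\<forall>t\<in>I. \<beta> n t - \<beta> 0 t = b n * \<alpha> 1 t + bh n * \<gamma> 0 t" for n by metis
    \<comment> \<open>The sequences obtained need not be normalised when \<open>\<alpha> 1\<close>
      and \<open>\<gamma> 0\<close> are proportional, so their first entries are overwritten; the
      identities at those indices are trivial, or follow from \<open>alpha0\<close>.\<close>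
    have \<alpha>: "\<alpha> n t = (a(0 := 0, 1 := 1)) n * \<alpha> 1 t + (ah(0 := 0, 1 := 0)) n * \<gamma> 0 t" if "t \<in> I" for n t
      using a[of n] alpha0 that by auto
    have \<gamma>: "\<gamma> n t = (c(0 := 0)) n * \<alpha> 1 t + (ch(0 := 1)) n * \<gamma> 0 t" if "t \<in> I" for n t
      using c[of n] that by auto
    have \<beta>: "\<beta> n t = \<beta> 0 t + (b(0 := 0)) n * \<alpha> 1 t + (bh(0 := 0)) n * \<gamma> 0 t" if "t \<in> I" for n t
    proof (cases "n = 0")
      case False
      have "\<beta> n t - \<beta> 0 t = b n * \<alpha> 1 t + bh n * \<gamma> 0 t" using b that by blast
      then show ?thesis using False by simp
    qed simp
    have pos: "\<alpha> n t * \<gamma> (n - 1) t > 0" if "t \<in> I" "n \<ge> 1" for n t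
      using alpha_gamma_pos[OF that(1), of "n - 1"] that(2) by simp
    show "\<exists>a ah b bh c ch :: nat \<Rightarrow> real.
       b 0 = 0 \<and> bh 0 = 0 \<and> ah 0 = 0 \<and> a 0 = 0 \<and> ah 1 = 0 \<and> c 0 = 0 \<and>
       a 1 = 1 \<and> ch 0 = 1 \<and>
       (\<forall>n. \<forall>t\<in>I.
          \<beta> n t = \<beta> 0 t + b n * \<alpha> 1 t + bh n * \<gamma> 0 t \<and>
          \<alpha> n t = a n * \<alpha> 1 t + ah n * \<gamma> 0 t \<and>
          \<gamma> n t = c n * \<alpha> 1 t + ch n * \<gamma> 0 t) \<and>
       (\<forall>t\<in>I. \<forall>n\<ge>1. \<alpha> n t * \<gamma> (n - 1) t > 0)"
      by (intro exI[of _ "a(0 := 0, 1 := 1)"] exI[of _ "ah(0 := 0, 1 := 0)"] exI[of _ "b(0 := 0)"]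
          exI[of _ "bh(0 := 0)"] exI[of _ "c(0 := 0)"] exI[of _ "ch(0 := 1)"] conjI allI ballI impI \<alpha> \<beta> \<gamma> pos) simp_all
  next
    assume "\<exists>a ah b bh c ch :: nat \<Rightarrow> real.
       b 0 = 0 \<and> bh 0 = 0 \<and> ah 0 = 0 \<and> a 0 = 0 \<and> ah 1 = 0 \<and> c 0 = 0 \<and>
       a 1 = 1 \<and> ch 0 = 1 \<and>
       (\<forall>n. \<forall>t\<in>I.
          \<beta> n t = \<beta> 0 t + b n * \<alpha> 1 t + bh n * \<gamma> 0 t \<and>
          \<alpha> n t = a n * \<alpha> 1 t + ah n * \<gamma> 0 t \<and>
          \<gamma> n t = c n * \<alpha> 1 t + ch n * \<gamma> 0 t) \<and>
       (\<forall>t\<in>I. \<forall>n\<ge>1. \<alpha> n t * \<gamma> (n - 1) t > 0)"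
    then obtain a ah b bh c ch :: "nat \<Rightarrow> real" where
      abc: "\<forall>n. \<forall>t\<in>I. \<beta> n t = \<beta> 0 t + b n * \<alpha> 1 t + bh n * \<gamma> 0 t \<and>
          \<alpha> n t = a n * \<alpha> 1 t + ah n * \<gamma> 0 t \<and> \<gamma> n t = c n * \<alpha> 1 t + ch n * \<gamma> 0 t"
      by (elim exE conjE) (rule that)
    show "harness M X I"
    proof (rule combination_imp_harness)
      fix f assume "f \<in> recurrence_functions"
      then consider n where "f = \<alpha> n" | n where "f = \<gamma> n" | n where "f = (\<lambda>t. \<beta> n t - \<beta> 0 t)"
        by (auto simp: recurrence_functions_def)
      then show "\<exists>x y. \<forall>t\<in>I. f t = x * \<alpha> 1 t + y * \<gamma> 0 t"
      proof cases
        case (1 n)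
        show ?thesis unfolding 1 using abc by blast
      next
        case (2 n)
        show ?thesis unfolding 2 using abc by blast
      next
        case (3 n)
        have "f t = b n * \<alpha> 1 t + bh n * \<gamma> 0 t" if "t \<in> I" for t
          using abc[rule_format, OF that, of n] unfolding 3 by linarith
        then show ?thesis by blast
      qed
    qed
  qed
qed

end
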